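(* Let $p\in\{2,3,4,5\}$. Then spectral implies tile for period $p$; that is, every bounded Borel subset $\Omega$ of $\mathbb{R}$ with Lebesgue measure $|\Omega|=1$ which has a spectrum $\Lambda$ of period $p$ (i.e. $\Lambda+p=\Lambda$) also tiles $\mathbb{R}$ by translations.
   Context: A bounded Borel set $\Omega\subset\mathbb{R}$ has spectrum $\Lambda\subset\mathbb{R}$ if $\{e^{2\pi i\lambda x}:\lambda\in\Lambda\}$ is an orthogonal basis of $L^2(\Omega)$ with respect to Lebesgue measure restricted to $\Omega$. $\Omega$ tiles $\mathbb{R}$ by translations if there exists a set $\mathcal{T}\subset\mathbb{R}$ such that $\{\Omega+t:t\in\mathcal{T}\}$ is a partition of $\mathbb{R}$ up to Lebesgue measure zero. *)

theory Defs
  imports "HOL-Analysis.Analysis"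
begin

definition square_integrable :: "'a measure \<Rightarrow> ('a \<Rightarrow> complex) \<Rightarrow> bool" where
  "square_integrable M f \<longleftrightarrow>
     f \<in> borel_measurable M \<and> integrable M (\<lambda>x. (cmod (f x))\<^sup>2)"

definition L2_inner :: "'a measure \<Rightarrow> ('a \<Rightarrow> complex) \<Rightarrow> ('a \<Rightarrow> complex) \<Rightarrow> complex" where
  "L2_inner M f g = (LINT x|M. f x * cnj (g x))"

definition L2_norm :: "'a measure \<Rightarrow> ('a \<Rightarrow> complex) \<Rightarrow> real" where
  "L2_norm M f = sqrt (LINT x|M. (cmod (f x))\<^sup>2)"

text \<open>
  The space \<open>L\<^sup>2(M)\<close> is represented by its square-integrable representatives. An
  orthogonal basis is a set of pairwise orthogonal vectors of nonzero norm whose finite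
  complex linear combinations are dense in \<open>L\<^sup>2(M)\<close>. Two distinct representatives of
  the same class cannot both occur in \<open>B\<close>, since they would have to be orthogonal.
\<close>
definition orthogonal_basis_L2 :: "'a measure \<Rightarrow> ('a \<Rightarrow> complex) set \<Rightarrow> bool" where
  "orthogonal_basis_L2 M B \<longleftrightarrow>
     (\<forall>g\<in>B. square_integrable M g \<and> L2_norm M g \<noteq> 0) \<and>
     (\<forall>g\<in>B. \<forall>h\<in>B. g \<noteq> h \<longrightarrow> L2_inner M g h = 0) \<and>
     (\<forall>f. square_integrable M f \<longrightarrow>
        (\<forall>\<epsilon>>0. \<exists>F c. finite F \<and> F \<subseteq> B \<and>
           L2_norm M (\<lambda>x. f x - (\<Sum>g\<in>F. c g * g x)) < \<epsilon>))"

definition exponential :: "real \<Rightarrow> real \<Rightarrow> complex" where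
  "exponential \<xi> x = exp (2 * of_real pi * \<i> * of_real \<xi> * of_real x)"

definition has_spectrum :: "real set \<Rightarrow> real set \<Rightarrow> bool" where
  "has_spectrum \<Omega> \<Lambda> \<longleftrightarrow> orthogonal_basis_L2 (lebesgue_on \<Omega>) (exponential ` \<Lambda>)"

definition tiles_by_translations :: "real set \<Rightarrow> bool" where
  "tiles_by_translations \<Omega> \<longleftrightarrow>
     (\<exists>T :: real set.
        (\<forall>s\<in>T. \<forall>t\<in>T. s \<noteq> t \<longrightarrow>
           negligible ((\<lambda>x. x + s) ` \<Omega> \<inter> (\<lambda>x. x + t) ` \<Omega>)) \<and>
        negligible (UNIV - (\<Union>t\<in>T. (\<lambda>x. x + t) ` \<Omega>)))"

end

theory Submission
  imports Defs
begin

text \<open>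
  Vanishing of all Fourier coefficients at frequencies in \<open>p\<int>\<close> turns orthogonality over
  \<open>\<Omega>\<close> into a pointwise statement: for almost every \<open>x\<close> the fibre \<open>{k \<in> \<int>. x + k / p \<in> \<Omega>}\<close> has
  \<open>p\<close> elements and the exponentials with frequencies \<open>\<gamma> / p\<close> are orthogonal on it, where \<open>\<gamma>\<close> runs
  through representatives of \<open>\<Lambda>\<close> modulo \<open>p\<close>; completeness and Bessel's inequality provide \<open>p\<close> such
  representatives. It remains to find one set of integers that tiles \<open>\<int>\<close> together with every
  \<open>p\<close>-element set having this spectrum. For \<open>p = 2, 3, 5\<close> the orthogonality matrix is
  equivalent to the Fourier matrix (for \<open>p = 5\<close> this is a theorem of Haagerup), so all differences
  within a fibre have the same \<open>p\<close>-adic valuation, which depends on the spectrum only. For \<open>p = 4\<close>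
  four unit numbers with sum zero form two antipodal pairs, which determines the 2-adic structure of
  the fibre.
\<close>

section \<open>Complex Hadamard matrices of order five\<close>

text \<open>The fibre over \<open>x\<close> may vary wildly with \<open>x\<close>, whereas a tiling
  of the line needs one set of translations for all \<open>x\<close>. A tiling complement for each
  single fibre would therefore not be enough: it has to be computable from the spectrum. Fibres
  appear because exponentials with frequencies in p Z have period 1/p, so integrals against them see
  a function only through its periodization. Representatives must be exactly as many as the points
  of a fibre: only a square matrix lets orthogonality pass from rows to columns. Fewer than p
  classes are impossible because each class is orthogonal on intervals of length 1/p, where Bessel's
  inequality lets it carry at most the fraction 1/p of the norm of a function. Order five is
  tractable because 5 = 3 + 2: for three rows, the product of the three inner products restricted to
  two columns is automatically real, which constrains the other three columns.\<close>

lemma unit_cnj: "cmod z = 1 \<Longrightarrow> cnj z = inverse z"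
  by (metis complex_norm_square inverse_unique mult.commute of_real_1 power_one)

text \<open>Under conjugation the sum becomes the sum of the pairwise products. If it is real, the
  two cancel in the expansion of
  \<open>(1 - \<alpha>) * (1 - \<beta>) * (1 - \<gamma>)\<close>.\<close>

lemma unit_triple_real_sum:
  fixes \<alpha> \<beta> \<gamma> :: complex
  assumes "cmod \<alpha> = 1" "cmod \<beta> = 1" "cmod \<gamma> = 1" and prod: "\<alpha> * \<beta> * \<gamma> = 1"
    and "Im (\<alpha> + \<beta> + \<gamma>) = 0"
  shows "\<alpha> = 1 \<or> \<beta> = 1 \<or> \<gamma> = 1"
proof -
  have "cnj (\<alpha> + \<beta> + \<gamma>) = \<alpha> + \<beta> + \<gamma>"
    using assms(5) by (simp add: complex_eq_iff)
  moreover have "cnj \<alpha> = \<beta> * \<gamma>" "cnj \<beta> = \<alpha> * \<gamma>" "cnj \<gamma> = \<alpha> * \<beta>"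
    using assms by (auto simp: unit_cnj mult_ac intro!: inverse_unique)
  ultimately have "(1 - \<alpha>) * (1 - \<beta>) * (1 - \<gamma>) = 0"
    using prod by (simp add: algebra_simps)
  thus ?thesis by auto
qed

text \<open>The rows (1,1,1,1,1), (1,a,b,s1,s2), (1,c,d,t1,t2) are pairwise orthogonal. Split each
  inner product into the first three columns and the last two. The product of the three two-column
  parts is always real, hence so is that of the three-column parts; its terms that repeat a column
  have real total, which leaves the six terms with three distinct columns.\<close>

lemma haagerup_real:
  fixes a b c d s1 s2 t1 t2 :: complex
  assumes "cmod a = 1" "cmod b = 1" "cmod c = 1" "cmod d = 1"
    and "cmod s1 = 1" "cmod s2 = 1" "cmod t1 = 1" "cmod t2 = 1"
    and x: "1 + a + b + s1 + s2 = 0" and y: "1 + c + d + t1 + t2 = 0"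
    and xy: "1 + cnj a * c + cnj b * d + cnj s1 * t1 + cnj s2 * t2 = 0"
  shows "Im (a * d * cnj b + b * cnj c + c * cnj a * cnj d)
       + Im (b * c * cnj a + a * cnj d + d * cnj b * cnj c) = 0"
proof -
  let ?X = "1 + a + b" and ?Y = "1 + cnj c + cnj d" and ?Z = "1 + cnj a * c + cnj b * d"
  let ?P = "(a * d * cnj b + b * cnj c + c * cnj a * cnj d) + (b * c * cnj a + a * cnj d
      + d * cnj b * cnj c)"
  have u: "a * cnj a = 1" "b * cnj b = 1" "c * cnj c = 1" "d * cnj d = 1"
    "s1 * cnj s1 = 1" "s2 * cnj s2 = 1" "t1 * cnj t1 = 1" "t2 * cnj t2 = 1"
    using assms by (simp_all flip: complex_norm_square)
  have "1 + cnj c + cnj d + cnj t1 + cnj t2 = cnj (1 + c + d + t1 + t2)" by simp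
  hence y': "1 + cnj c + cnj d + cnj t1 + cnj t2 = 0" using y by simp
  have "?X = - (s1 + s2)" "?Y = - (cnj t1 + cnj t2)" "?Z = - (cnj s1 * t1 + cnj s2 * t2)"
    using x y' xy by algebra+
  hence "?X * ?Y * ?Z = - ((s1 + s2) * (cnj t1 + cnj t2) * (cnj s1 * t1 + cnj s2 * t2))"
    by (simp only: mult_minus_left mult_minus_right minus_minus)
  also have "(s1 + s2) * (cnj t1 + cnj t2) * (cnj s1 * t1 + cnj s2 * t2) =
     (s1 * cnj s1) * (t1 * cnj t1) + (s2 * cnj s2) * (t2 * cnj t2)
   + (s1 * cnj s1) * (t1 * cnj t2 + 0) + (s2 * cnj s2) * (t2 * cnj t1)
   + (t1 * cnj t1) * (s2 * cnj s1) + (t2 * cnj t2) * (s1 * cnj s2)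
   + (s1 * cnj s2) * cnj (t1 * cnj t2) + cnj (s1 * cnj s2) * (t1 * cnj t2)"
    by (simp add: algebra_simps)
  also have "Im (- \<dots>) = 0" unfolding u by (simp add: algebra_simps)
  finally have A: "Im (?X * ?Y * ?Z) = 0" .
  \<comment> \<open>The 21 products in which some column occurs twice, grouped so that unit modulus
    leaves only constants and conjugate pairs.\<close>
  let ?R = "1 + (a * cnj a) * (c * cnj c) + (b * cnj b) * (d * cnj d)
    + (cnj c + cnj d + (a * cnj a) * c + (b * cnj b) * d
       + (a * cnj a) * (c * cnj d) + (b * cnj b) * (d * cnj c))
    + ((c * cnj c) * cnj a + a + (d * cnj d) * cnj b + b
       + (c * cnj c) * (b * cnj a) + (d * cnj d) * (a * cnj b))
    + (c * cnj a + a * cnj c + d * cnj b + b * cnj d + (a * cnj b) * (d * cnj c)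
       + cnj (a * cnj b) * cnj (d * cnj c))"
  have "?X * ?Y * ?Z = ?P + ?R" by (simp add: algebra_simps)
  moreover have "Im ?R = 0" unfolding u by (simp add: algebra_simps)
  ultimately have "Im (?X * ?Y * ?Z) = Im ?P" by (simp only: plus_complex.sel add_0_right)
  thus ?thesis using A by simp
qed

lemma card_5_split:
  assumes "card J = 5" "{a, b, c} \<subseteq> J" "distinct [a, b, c]"
  shows "\<exists>s t. J = {a, b, c, s, t} \<and> distinct [a, b, c, s, t]"
proof -
  have "finite J" using assms(1) by (metis card.infinite zero_neq_numeral)
  hence "card (J - {a, b, c}) = 2"
    using assms by (subst card_Diff_subset) auto
  then obtain s t where st: "J - {a, b, c} = {s, t}" "s \<noteq> t" by (auto simp: card_2_iff)
  moreover have "J = {a, b, c} \<union> (J - {a, b, c})" using assms by blast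
  ultimately have "J = {a, b, c, s, t}" by auto
  moreover have "distinct [a, b, c, s, t]" using st assms(3) by auto
  ultimately show ?thesis by blast
qed

lemma unit_mult_cnj_eq_1_iff:
  fixes a b :: complex
  assumes "cmod b = 1"
  shows "a * cnj b = 1 \<longleftrightarrow> a = b"
  using assms by (auto simp: unit_cnj divide_simps simp flip: divide_inverse)

locale dephased_hadamard_5 =
  fixes I :: "'a set" and J :: "'b set" and h :: "'a \<Rightarrow> 'b \<Rightarrow> complex" and i0 :: 'a and j0 :: 'b
  assumes card_rows: "card I = 5" and card_cols: "card J = 5"
    and i0: "i0 \<in> I" and j0: "j0 \<in> J"
    and unit: "\<And>i j. i \<in> I \<Longrightarrow> j \<in> J \<Longrightarrow> cmod (h i j) = 1"
    and rows: "\<And>i i'. i \<in> I \<Longrightarrow> i' \<in> I \<Longrightarrow> i \<noteq> i' \<Longrightarrow> (\<Sum>j\<in>J. cnj (h i j) * h i' j) = 0"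
    and cols: "\<And>j j'. j \<in> J \<Longrightarrow> j' \<in> J \<Longrightarrow> j \<noteq> j' \<Longrightarrow> (\<Sum>i\<in>I. cnj (h i j) * h i j') = 0"
    and row0: "\<And>j. j \<in> J \<Longrightarrow> h i0 j = 1"
    and col0: "\<And>i. i \<in> I \<Longrightarrow> h i j0 = 1"
begin

lemma transposed: "dephased_hadamard_5 J I (\<lambda>j i. h i j) j0 i0"
  by unfold_locales (use card_rows card_cols i0 j0 unit rows cols row0 col0 in auto)

lemma row_sum: "i \<in> I - {i0} \<Longrightarrow> (\<Sum>j\<in>J. h i j) = 0"
  using rows[of i0 i] i0 row0 by auto

lemma minor_im:
  assumes i: "i \<in> I - {i0}" "i' \<in> I - {i0}" "i \<noteq> i'"
    and j: "j \<in> J - {j0}" "j' \<in> J - {j0}" "j \<noteq> j'"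
  defines "a \<equiv> h i j" and "b \<equiv> h i j'" and "c \<equiv> h i' j" and "d \<equiv> h i' j'"
  shows "Im (a * d * cnj b + b * cnj c + c * cnj a * cnj d)
       + Im (b * c * cnj a + a * cnj d + d * cnj b * cnj c) = 0"
proof -
  obtain s t where J: "J = {j0, j, j', s, t}" and dist: "distinct [j0, j, j', s, t]"
    using card_5_split[OF card_cols, of j0 j j'] j j0 by auto
  show ?thesis unfolding a_def b_def c_def d_def
  proof (rule haagerup_real[where ?s1.0 = "h i s" and ?s2.0 = "h i t" and ?t1.0
      = "h i' s" and ?t2.0 = "h i' t"])
    show "1 + h i j + h i j' + h i s + h i t = 0"
      using row_sum[of i] i dist col0[of i] unfolding J by (simp add: add_ac)
    show "1 + h i' j + h i' j' + h i' s + h i' t = 0"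
      using row_sum[of i'] i dist col0[of i'] unfolding J by (simp add: add_ac)
    show "1 + cnj (h i j) * h i' j + cnj (h i j') * h i' j' + cnj (h i s) * h i' s
        + cnj (h i t) * h i' t = 0"
      using rows[of i i'] i dist col0[of i] col0[of i'] unfolding J by (simp add: add_ac)
  qed (use unit i J in auto)
qed

text \<open>Transposition conjugates the contribution of the even permutations and fixes that of the
  odd ones, so both are real; each is a sum of three unit numbers with product 1.\<close>

lemma minor_relations:
  assumes i: "i \<in> I - {i0}" "i' \<in> I - {i0}" "i \<noteq> i'"
    and j: "j \<in> J - {j0}" "j' \<in> J - {j0}" "j \<noteq> j'"
  defines "a \<equiv> h i j" and "b \<equiv> h i j'" and "c \<equiv> h i' j" and "d \<equiv> h i' j'"
  shows "a * d = b \<or> b = c \<or> c = a * d" and "b * c = a \<or> a = d \<or> d = b * c"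
proof -
  interpret T: dephased_hadamard_5 J I "\<lambda>j i. h i j" j0 i0 by (rule transposed)
  have u: "cmod a = 1" "cmod b = 1" "cmod c = 1" "cmod d = 1"
    using i j unit by (auto simp: a_def b_def c_def d_def)
  hence n: "a * cnj a = 1" "b * cnj b = 1" "c * cnj c = 1" "d * cnj d = 1"
    by (simp_all flip: complex_norm_square)
  have 1: "Im (a * d * cnj b + b * cnj c + c * cnj a * cnj d)
       + Im (b * c * cnj a + a * cnj d + d * cnj b * cnj c) = 0"
    unfolding a_def b_def c_def d_def by (rule minor_im[OF i j])
  have 2: "Im (a * d * cnj c + c * cnj b + b * cnj a * cnj d)
       + Im (c * b * cnj a + a * cnj d + d * cnj c * cnj b) = 0"
    unfolding a_def b_def c_def d_def by (rule T.minor_im[OF j i])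
  have "a * d * cnj c + c * cnj b + b * cnj a * cnj d
      = cnj (a * d * cnj b + b * cnj c + c * cnj a * cnj d)" by (simp add: algebra_simps)
  hence "Im (a * d * cnj c + c * cnj b + b * cnj a * cnj d) =
    - Im (a * d * cnj b + b * cnj c + c * cnj a * cnj d)" by (metis cnj.sel(2))
  moreover have "Im (c * b * cnj a + a * cnj d + d * cnj c * cnj b)
      = Im (b * c * cnj a + a * cnj d + d * cnj b * cnj c)" by (simp only: mult_ac)
  ultimately have E: "Im (a * d * cnj b + b * cnj c + c * cnj a * cnj d) = 0"
    and O: "Im (b * c * cnj a + a * cnj d + d * cnj b * cnj c) = 0" using 1 2 by linarith+
  have "(a * d * cnj b) * (b * cnj c) * (c * cnj a * cnj d)
    = (a * cnj a) * (b * cnj b) * (c * cnj c) * (d * cnj d)" by (simp add: algebra_simps)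
  hence "a * d * cnj b = 1 \<or> b * cnj c = 1 \<or> c * cnj a * cnj d = 1"
    using n u E by (intro unit_triple_real_sum) (simp_all add: norm_mult)
  moreover have "c * cnj a * cnj d = c * cnj (a * d)" by simp
  ultimately show "a * d = b \<or> b = c \<or> c = a * d"
    using u unit_mult_cnj_eq_1_iff by (metis norm_mult mult_1)
  have "(b * c * cnj a) * (a * cnj d) * (d * cnj b * cnj c)
    = (a * cnj a) * (b * cnj b) * (c * cnj c) * (d * cnj d)" by (simp add: algebra_simps)
  hence "b * c * cnj a = 1 \<or> a * cnj d = 1 \<or> d * cnj b * cnj c = 1"
    using n u O by (intro unit_triple_real_sum) (simp_all add: norm_mult)
  moreover have "d * cnj b * cnj c = d * cnj (b * c)" by simp
  ultimately show "b * c = a \<or> a = d \<or> d = b * c"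
    using u unit_mult_cnj_eq_1_iff by (metis norm_mult mult_1)
qed

end

section \<open>The value 1 does not occur in the core of a dephased matrix\<close>

lemma no_three_ones:
  assumes "cmod x = 1" "cmod y = 1" "3 + x + y = 0"
  shows False
proof -
  have "x + y = - 3" using assms(3) by (simp add: eq_neg_iff_add_eq_0 add_ac)
  hence "3 = cmod (x + y)" by simp
  also have "\<dots> \<le> 2" using norm_triangle_ineq[of x y] assms by simp
  finally show False by simp
qed

text \<open>A further 1 would make three, too many for two unit numbers to balance. So each of
  \<open>x\<close>, \<open>y\<close>, \<open>z\<close> is \<open>w\<close> or its conjugate; the
  imaginary parts add up to an odd multiple of \<open>Im w\<close>, so \<open>w\<close> is real, and
  then the real parts add up to 3 or -3 instead of -2.\<close>

lemma two_ones_not_vanishing: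
  fixes w :: complex
  assumes w: "cmod w = 1" "w \<noteq> 1"
    and u: "cmod x = 1" "cmod y = 1" "cmod z = 1"
    and e: "x \<in> {1, w, inverse w}" "y \<in> {1, w, inverse w}" "z \<in> {1, w, inverse w}"
    and s: "2 + x + y + z = 0"
  shows False
proof -
  have "x \<noteq> 1" "y \<noteq> 1" "z \<noteq> 1"
    using no_three_ones[of y z] no_three_ones[of x z] no_three_ones[of x y] u s
    by (auto simp: add_ac)
  hence e: "x \<in> {w, cnj w}" "y \<in> {w, cnj w}" "z \<in> {w, cnj w}"
    using e w by (auto simp: unit_cnj)
  have "Im (2 + x + y + z) = 0" "Re (2 + x + y + z) = 0" using s by simp_all
  hence im: "Im x + Im y + Im z = 0" and re: "Re x + Re y + Re z = -2" by simp_all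
  have "Im w = 0" using im e by auto
  hence "\<bar>Re w\<bar> = 1" using w by (simp add: cmod_def)
  hence "Re w = 1 \<or> Re w = -1" by linarith
  thus False using re e by auto
qed

context dephased_hadamard_5 begin

text \<open>If \<open>h i j = 1\<close>, the minor relations with another row, whose entry in column
  \<open>j\<close> is \<open>w\<close>, confine every further entry of row \<open>i\<close> to 1,
  \<open>w\<close> or \<open>inverse w\<close>. Row \<open>i\<close> would then be a vanishing sum
  with two ones of the kind excluded before.\<close>

lemma core_neq_1:
  assumes i: "i \<in> I - {i0}" and j: "j \<in> J - {j0}"
  shows "h i j \<noteq> 1"
proof
  assume one: "h i j = 1"
  interpret T: dephased_hadamard_5 J I "\<lambda>j i. h i j" j0 i0 by (rule transposed)
  have "card (I - {i0, i}) = 3" using card_rows i i0 by (subst card_Diff_subset) auto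
  then obtain i' where i': "i' \<in> I" "i' \<noteq> i0" "i' \<noteq> i"
    by (metis Diff_iff card.empty ex_in_conv insertCI zero_neq_numeral)
  define w where "w = h i' j"
  have w: "cmod w = 1" using unit i' j by (simp add: w_def)
  have w1: "w \<noteq> 1"
  proof
    assume "w = 1"
    obtain s t where "I = {i0, i, i', s, t}" "distinct [i0, i, i', s, t]"
      using card_5_split[OF card_rows, of i0 i i'] i i' i0 by auto
    thus False using T.row_sum[OF j] one \<open>w = 1\<close> row0[of j] j unit[of s j] unit[of t j]
      no_three_ones[of "h s j" "h t j"] by (simp add: w_def add_ac)
  qed
  have "card (J - {j0, j}) = 3" using card_cols j j0 by (subst card_Diff_subset) auto
  then obtain j' where j': "j' \<in> J" "j' \<noteq> j0" "j' \<noteq> j"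
    by (metis Diff_iff card.empty ex_in_conv insertCI zero_neq_numeral)
  obtain s t where J: "J = {j0, j, j', s, t}" "distinct [j0, j, j', s, t]"
    using card_5_split[OF card_cols, of j0 j j'] j j' j0 by auto
  have sum: "2 + h i j' + h i s + h i t = 0"
    using row_sum[OF i] J one col0[of i] i by (simp add: add_ac)
  have "h i k \<in> {1, w, inverse w}" if k: "k \<in> J - {j0, j}" for k
  proof -
    have "w \<noteq> 0" using w by auto
    have "h i k \<noteq> 0" using unit[of i k] i k by auto
    have "h i' k = h i k \<or> h i k = w \<or> w = h i' k" "h i k * w = 1 \<or> 1 = h i' k \<or> h i' k = h i k * w"
      using minor_relations[of i i' j k] i i' j k by (auto simp: one w_def)
    hence "h i k * w = 1 \<or> h i k = w \<or> h i k = 1" 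
      using w1 \<open>w \<noteq> 0\<close> \<open>h i k \<noteq> 0\<close> by auto
    thus ?thesis using \<open>w \<noteq> 0\<close> by (auto simp: field_simps)
  qed
  thus False
    using two_ones_not_vanishing[OF w w1 _ _ _ _ _ _ sum] J unit i by auto
qed

end

section \<open>The core consists of fifth roots of unity\<close>

lemma root_of_unity_3: "1 + x + x\<^sup>2 = 0 \<Longrightarrow> x ^ 3 = 1" for x :: complex
proof -
  assume "1 + x + x\<^sup>2 = 0"
  moreover have "x ^ 3 - 1 = (x - 1) * (1 + x + x\<^sup>2)"
    by (simp add: algebra_simps power2_eq_square power3_eq_cube)
  ultimately show ?thesis by simp
qed

lemma root_of_unity_5: "1 + x + x\<^sup>2 + x ^ 3 + x ^ 4 = 0 \<Longrightarrow> x ^ 5 = 1" for x :: complex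
proof -
  assume "1 + x + x\<^sup>2 + x ^ 3 + x ^ 4 = 0"
  moreover have "x ^ 5 - 1 = (x - 1) * (1 + x + x\<^sup>2 + x ^ 3 + x ^ 4)"
    by (simp add: algebra_simps eval_nat_numeral)
  ultimately show ?thesis by simp
qed

lemma neg_square_cubes: "x = - y\<^sup>2 \<Longrightarrow> y ^ 3 = 1 \<Longrightarrow> x ^ 3 \<noteq> 1" for x y :: complex
proof
  assume "x = - y\<^sup>2" "y ^ 3 = 1" "x ^ 3 = 1"
  moreover have "(- y\<^sup>2) ^ 3 = - ((y ^ 3)\<^sup>2)" by (simp add: power_mult [symmetric])
  ultimately show False by simp
qed

lemma neg_square_eq_cube: "x = - y\<^sup>2 \<Longrightarrow> x = y ^ 3 \<Longrightarrow> y \<noteq> 0 \<Longrightarrow> x = y" for x y :: complex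
proof -
  assume *: "x = - y\<^sup>2" "x = y ^ 3" "y \<noteq> 0"
  hence "y\<^sup>2 * (y + 1) = 0" by (simp add: algebra_simps power2_eq_square power3_eq_cube)
  hence "y = -1" using * by (simp add: eq_neg_iff_add_eq_0)
  thus ?thesis using * by simp
qed

text \<open>Since \<open>a + inverse a\<close> is real, so is \<open>u + v\<close>, and the
  conjugate of \<open>u + v\<close> is \<open>(u + v) / (u * v)\<close>.\<close>

lemma unit_pair_real_sum:
  assumes "cmod a = 1" "cmod u = 1" "cmod v = 1" and s: "1 + a + inverse a + u + v = 0"
  shows "u * v = 1 \<or> u + v = 0 \<and> a ^ 3 = 1"
proof -
  have nz: "a \<noteq> 0" "u \<noteq> 0" "v \<noteq> 0" using assms by auto
  have "1 + inverse a + a + inverse u + inverse v = cnj (1 + a + inverse a + u + v)"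
    using assms(1-3) by (simp add: unit_cnj)
  hence e: "1 + inverse a + a + inverse u + inverse v = 0" by (simp add: s)
  have "(1 + a + inverse a + u + v) - (1 + inverse a + a + inverse u + inverse v) = 0"
    unfolding s e by simp
  hence "(u + v) - (inverse u + inverse v) = 0" by (simp add: algebra_simps)
  hence "u + v = inverse u + inverse v" by (simp only: right_minus_eq)
  hence "(u + v) * (u * v - 1) = 0" using nz by (simp add: field_simps)
  moreover have "a ^ 3 = 1" if "u + v = 0"
  proof -
    have "1 + a + inverse a = 0" using s that by (simp add: add.assoc)
    hence "1 + a + a\<^sup>2 = 0" using nz by (simp add: field_simps power2_eq_square)
    thus ?thesis by (rule root_of_unity_3)
  qed
  ultimately show ?thesis by auto
qed

text \<open>If none of the three relations holds, solving the nine combinations of relations leaves six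
  possible values of \<open>(c, d)\<close>, forming two blocks of three (\<open>P1\<close> and \<open>P2\<close>); two of the three rows lie
  in the same block, and the column sums then contradict each other.\<close>

lemma core_pair_special:
  fixes a b c1 c2 c3 d1 d2 d3 :: complex
  assumes u: "cmod a = 1" "cmod b = 1" "cmod c1 = 1" "cmod c2 = 1" "cmod c3 = 1"
      "cmod d1 = 1" "cmod d2 = 1" "cmod d3 = 1"
    and a1: "a \<noteq> 1" and b1: "b \<noteq> 1" and ab: "a \<noteq> b"
    and cd: "distinct [c1, c2, c3]" and dd: "distinct [d1, d2, d3]"
    and rel: "\<And>c d. (c, d) \<in> {(c1, d1), (c2, d2), (c3, d3)} \<Longrightarrow>
        (a * d = b \<or> b = c \<or> c = a * d) \<and> (b * c = a \<or> a = d \<or> d = b * c)"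
    and sc: "1 + a + c1 + c2 + c3 = 0" and sd: "1 + b + d1 + d2 + d3 = 0"
  shows "b = a\<^sup>2 \<or> a = b\<^sup>2 \<or> a * b = 1"
proof (rule ccontr)
  assume neg: "\<not> ?thesis"
  have nz: "a \<noteq> 0" "b \<noteq> 0" using u by auto
  \<comment> \<open>Six of the nine combinations of relations determine \<open>(c, d)\<close>. The
    other three give the excluded cases: \<open>a * d = b\<close> with \<open>a = d\<close> yields
    \<open>b = a^2\<close>, \<open>b = c\<close> with \<open>b * c = a\<close> yields
    \<open>a = b^2\<close>, and \<open>c = a * d\<close> with \<open>d = b * c\<close> yields
    \<open>a * b = 1\<close>.\<close>
  define P1 where "P1 = {(a / b, b / a), (1 / a, b / a), (a / b, 1 / b)}"
  define P2 where "P2 = {(a\<^sup>2, a), (b, b\<^sup>2), (b, a)}"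
  have mem: "(c, d) \<in> P1 \<union> P2" if "(c, d) \<in> {(c1, d1), (c2, d2), (c3, d3)}" for c d
  proof -
    have "d \<noteq> 0" using that u by auto
    thus ?thesis using rel[OF that] neg nz a1 b1 ab unfolding P1_def P2_def
      by (auto simp: field_simps power2_eq_square)
  qed
  \<comment> \<open>Within a block only two members can differ in both coordinates; the third shares
    a coordinate with each of them. This fixes the coordinate sums.\<close>
  have two1: "c + c' = 1 / a + a / b \<and> d + d' = b / a + 1 / b"
    if "(c, d) \<in> P1" "(c', d') \<in> P1" "c \<noteq> c'" "d \<noteq> d'" for c d c' d'
    using that unfolding P1_def by auto
  have two2: "c + c' = a\<^sup>2 + b \<and> d + d' = a + b\<^sup>2"
    if "(c, d) \<in> P2" "(c', d') \<in> P2" "c \<noteq> c'" "d \<noteq> d'" for c d c' d'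
    using that unfolding P2_def by auto
  have no1: False if "(c, d) \<in> P1" "(c', d') \<in> P1" "distinct [c, c', c'']" "distinct [d, d', d'']"
      "1 + a + c + c' + c'' = 0" "1 + b + d + d' + d'' = 0" "cmod c'' = 1" "cmod d'' = 1"
      "(c'', d'') \<in> P1 \<union> P2" for c d c' d' c'' d''
  proof (cases "(c'', d'') \<in> P1")
    case True
    hence "c + c' = c + c''" using two1[of c d c' d'] two1[of c d c'' d''] that by simp
    thus False using that by simp
  next
    case False
    \<comment> \<open>With two rows in \<open>P1\<close>, both column sums consist of 1, a unit
      number, its inverse and two more unit numbers, the shape of
      \<open>unit_pair_real_sum\<close>.\<close>
    have "1 + a + inverse a + a / b + c'' = 0" "1 + b + inverse b + b / a + d'' = 0"
      using two1[of c d c' d'] that by (auto simp: field_simps)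
    hence "a / b * c'' = 1 \<or> a / b + c'' = 0 \<and> a ^ 3 = 1" "b / a * d'' = 1 \<or> b / a + d'' = 0
        \<and> b ^ 3 = 1"
      using u that(7,8) by (intro unit_pair_real_sum; simp add: norm_divide)+
    hence *: "a * c'' = b \<or> c'' * b = - a \<and> a ^ 3 = 1" "b * d'' = a \<or> d'' * a = - b \<and> b ^ 3 = 1"
      using nz by (auto simp: field_simps eq_neg_iff_add_eq_0)
    from False that(9) consider "c'' = a\<^sup>2 \<and> d'' = a" | "c'' = b \<and> d'' = b\<^sup>2" | "c'' = b \<and> d'' = a"
      unfolding P2_def by auto
    thus False
    proof cases
      case 1
      hence b: "b = - a\<^sup>2" "b ^ 3 = 1" using * nz b1 by (auto simp: power2_eq_square)
      have "a ^ 3 = b \<or> a ^ 3 = 1" using *(1) 1 by (auto simp: eval_nat_numeral)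
      thus ?thesis using neg_square_cubes[of b a] neg_square_eq_cube[of b a] b nz ab by auto
    next
      case 2
      hence a: "a = - b\<^sup>2" "a ^ 3 = 1" using * nz a1 by (auto simp: power2_eq_square)
      have "b ^ 3 = a \<or> b ^ 3 = 1" using *(2) 2 by (auto simp: eval_nat_numeral)
      thus ?thesis using neg_square_cubes[of a b] neg_square_eq_cube[of a b] a nz ab by auto
    next
      case 3
      hence "a = - b\<^sup>2" "a ^ 3 = 1" "b ^ 3 = 1" using * nz a1 b1 by (auto simp: power2_eq_square)
      thus ?thesis using neg_square_cubes[of a b] by auto
    qed
  qed
  have no2: False if "(c, d) \<in> P2" "(c', d') \<in> P2" "distinct [c, c', c'']" "distinct [d, d', d'']"
      "1 + a + c + c' + c'' = 0" "1 + b + d + d' + d'' = 0" "cmod c'' = 1" "cmod d'' = 1"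
      "(c'', d'') \<in> P1 \<union> P2" for c d c' d' c'' d''
  proof (cases "(c'', d'') \<in> P2")
    case True
    hence "c + c' = c + c''" using two2[of c d c' d'] two2[of c d c'' d''] that by simp
    thus False using that by simp
  next
    case False
    have "1 + a + c'' + a\<^sup>2 + b = 0" "1 + b + d'' + a + b\<^sup>2 = 0"
      using two2[of c d c' d'] that by (auto simp: algebra_simps)
    \<comment> \<open>Division by \<open>a\<close>, respectively \<open>b\<close>, restores the
      shape required by \<open>unit_pair_real_sum\<close>.\<close>
    hence "1 + a + inverse a + b / a + c'' / a = 0" "1 + b + inverse b + a / b + d'' / b = 0"
      using nz by (auto simp: field_simps power2_eq_square)
    hence "b / a * (c'' / a) = 1 \<or> b / a + c'' / a = 0 \<and> a ^ 3 = 1"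
      "a / b * (d'' / b) = 1 \<or> a / b + d'' / b = 0 \<and> b ^ 3 = 1"
      using u that(7,8) by (intro unit_pair_real_sum; simp add: norm_divide)+
    hence *: "b * c'' = a\<^sup>2 \<or> c'' = - b \<and> a ^ 3 = 1" "a * d'' = b\<^sup>2 \<or> d'' = - a \<and> b ^ 3 = 1"
      using nz by (auto simp: field_simps eq_neg_iff_add_eq_0 power2_eq_square)
    from False that(9) consider "c'' * b = a \<and> d'' * a = b" | "c'' * a = 1 \<and> d'' * a
        = b" | "c'' * b = a \<and> d'' * b = 1"
      unfolding P1_def using nz by (auto simp: field_simps)
    thus False
    proof cases
      case 1
      hence "a = - b\<^sup>2" "a ^ 3 = 1" "b ^ 3 = 1"
        using * nz a1 b1 by (auto simp: power2_eq_square mult.commute)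
      thus ?thesis using neg_square_cubes[of a b] by auto
    next
      case 2
      hence b: "b = - a\<^sup>2" "b ^ 3 = 1" using * nz b1 by (auto simp: power2_eq_square mult.commute)
      have "a ^ 3 = b \<or> a ^ 3 = 1"
      proof -
        have "a ^ 3 = b * (c'' * a)" if "b * c'' = a\<^sup>2"
          using that by (simp add: eval_nat_numeral mult_ac)
        thus ?thesis using *(1) 2 by auto
      qed
      thus ?thesis using neg_square_cubes[of b a] neg_square_eq_cube[of b a] b nz ab by auto
    next
      case 3
      hence a: "a = - b\<^sup>2" "a ^ 3 = 1" using * nz a1 by (auto simp: power2_eq_square mult.commute)
      have "b ^ 3 = a \<or> b ^ 3 = 1"
      proof -
        have "b ^ 3 = a * (d'' * b)" if "a * d'' = b\<^sup>2"
          using that by (simp add: eval_nat_numeral mult_ac)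
        thus ?thesis using *(2) 3 by auto
      qed
      thus ?thesis using neg_square_cubes[of a b] neg_square_eq_cube[of a b] a nz ab by auto
    qed
  qed
  have m: "(c1, d1) \<in> P1 \<union> P2" "(c2, d2) \<in> P1 \<union> P2" "(c3, d3) \<in> P1 \<union> P2"
    using mem by auto
  have s: "1 + a + c1 + c3 + c2 = 0" "1 + a + c2 + c3 + c1 = 0"
    "1 + b + d1 + d3 + d2 = 0" "1 + b + d2 + d3 + d1 = 0" using sc sd by (simp_all add: add_ac)
  have "distinct [c1, c3, c2]" "distinct [c2, c3, c1]" "distinct [d1, d3, d2]"
      "distinct [d2, d3, d1]"
    using cd dd by auto
  note r = no1[OF _ _ cd dd sc sd u(5,8) m(3)] no1[OF _ _ this(1,3) s(1,3) u(4,7) m(2)]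
    no1[OF _ _ this(2,4) s(2,4) u(3,6) m(1)] no2[OF _ _ cd dd sc sd u(5,8) m(3)]
    no2[OF _ _ this(1,3) s(1,3) u(4,7) m(2)] no2[OF _ _ this(2,4) s(2,4) u(3,6) m(1)]
  show False using m r by blast
qed

text \<open>Without an inverse of \<open>a\<close>, each of the other three is \<open>a^2\<close> or
  a square root of \<open>a\<close>. As they are distinct, one is \<open>a^2\<close> and the other
  two are opposite square roots, which cancel. Then \<open>1 + a + a^2 = 0\<close>, so
  \<open>a^2\<close> is the inverse of \<open>a\<close> after all.\<close>

lemma special_has_inverse:
  fixes a b c d :: complex
  assumes s: "1 + a + b + c + d = 0" and d: "distinct [b, c, d]"
    and b: "b = a\<^sup>2 \<or> a = b\<^sup>2 \<or> a * b = 1"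
    and c: "c = a\<^sup>2 \<or> a = c\<^sup>2 \<or> a * c = 1"
    and d': "d = a\<^sup>2 \<or> a = d\<^sup>2 \<or> a * d = 1"
  shows "a * b = 1 \<or> a * c = 1 \<or> a * d = 1"
proof (rule ccontr)
  assume neg: "\<not> ?thesis"
  have neg_root: "y = - x" if "a = x\<^sup>2" "a = y\<^sup>2" "x \<noteq> y" for x y
    using that by (metis power2_eq_iff)
  have "a * a\<^sup>2 = 1" if "x = a\<^sup>2" "a = y\<^sup>2" "a = z\<^sup>2" "y \<noteq> z" "1 + a + x + y + z = 0" for x y z
  proof -
    have "1 + a + a\<^sup>2 = 0" using neg_root[OF that(2-4)] that(1,5) by simp
    hence "a ^ 3 = 1" by (rule root_of_unity_3)
    thus ?thesis by (simp add: power2_eq_square power3_eq_cube mult.assoc)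
  qed
  note * = this
  from b c d' neg have "b = a\<^sup>2 \<or> a = b\<^sup>2" "c = a\<^sup>2 \<or> a = c\<^sup>2" "d = a\<^sup>2 \<or> a = d\<^sup>2" by blast+
  moreover have "\<not> (a = b\<^sup>2 \<and> a = c\<^sup>2 \<and> a = d\<^sup>2)"
  proof
    assume "a = b\<^sup>2 \<and> a = c\<^sup>2 \<and> a = d\<^sup>2"
    hence "c = - b" "d = - b" using neg_root d by (metis distinct_length_2_or_more)+
    thus False using d by simp
  qed
  moreover have "b \<noteq> c" "b \<noteq> d" "c \<noteq> d" using d by auto
  ultimately consider "b = a\<^sup>2" "a = c\<^sup>2" "a = d\<^sup>2" | "c = a\<^sup>2" "a = b\<^sup>2" "a = d\<^sup>2"
    | "d = a\<^sup>2" "a = b\<^sup>2" "a = c\<^sup>2" by metis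
  thus False
  proof cases
    case 1
    thus ?thesis using *[OF 1(1,2,3) \<open>c \<noteq> d\<close>] s neg by simp
  next
    case 2
    have "1 + a + c + b + d = 0" using s by (simp add: add_ac)
    thus ?thesis using *[OF 2(1,2,3) \<open>b \<noteq> d\<close>] 2(1) neg by simp
  next
    case 3
    have "1 + a + d + b + c = 0" using s by (simp add: add_ac)
    thus ?thesis using *[OF 3(1,2,3) \<open>b \<noteq> c\<close>] 3(1) neg by simp
  qed
qed

text \<open>The four numbers split into two inverse pairs, and one member of a pair is the square of
  a member of the other. So together with 1 they are five consecutive powers of one number, and
  shifting the exponents by two turns the vanishing sum into the fifth cyclotomic equation.\<close>

lemma special_fifth_root:
  fixes a b c d :: complex
  assumes s: "1 + a + b + c + d = 0" and dist: "distinct [a, b, c, d]"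
    and sp: "\<And>x y. {x, y} \<subseteq> {a, b, c, d} \<Longrightarrow> x \<noteq> y \<Longrightarrow> y = x\<^sup>2 \<or> x = y\<^sup>2 \<or> x * y = 1"
  shows "a ^ 5 = 1"
proof -
  have *: "a ^ 5 = 1" if s: "1 + a + b + c + d = 0" and dist: "distinct [a, b, c, d]"
    and sp: "\<And>x y. {x, y} \<subseteq> {a, b, c, d} \<Longrightarrow> x \<noteq> y \<Longrightarrow> y = x\<^sup>2 \<or> x = y\<^sup>2 \<or> x * y = 1"
    and ab: "a * b = 1" for a b c d :: complex
  proof -
    have "c * a = 1 \<or> c * b = 1 \<or> c * d = 1"
    proof (rule special_has_inverse)
      show "1 + c + a + b + d = 0" using s by (simp add: add_ac)
      show "distinct [a, b, d]" using dist by simp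
    qed (rule sp; use dist in auto)+
    moreover have "c * a \<noteq> 1" "c * b \<noteq> 1" using ab dist
        by (auto dest!: inverse_unique simp: mult.commute)
    ultimately have cd: "c * d = 1" by simp
    have "c = a\<^sup>2 \<or> a = c\<^sup>2 \<or> a * c = 1" by (rule sp) (use dist in simp_all)
    moreover have "a * c \<noteq> 1" using \<open>c * a \<noteq> 1\<close> by (simp add: mult.commute)
    ultimately consider "c = a\<^sup>2" | "a = c\<^sup>2" by blast
    thus ?thesis
    proof cases
      case 1
      have "1 + a + a\<^sup>2 + a ^ 3 + a ^ 4 = 1 * a * a + a\<^sup>2 * a + (a * b) * a + a ^ 4 + c * d"
        using ab cd by (simp add: eval_nat_numeral)
      also have "\<dots> = a\<^sup>2 * (1 + a + b + c + d)"
        using 1 by (simp add: eval_nat_numeral algebra_simps)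
      finally show ?thesis using s by (intro root_of_unity_5) simp
    next
      case 2
      have "1 + c + c\<^sup>2 + c ^ 3 + c ^ 4 = a * b + (c * d) * c + c\<^sup>2 + c ^ 3 + c ^ 4"
        using ab cd by simp
      also have "\<dots> = c\<^sup>2 * (1 + a + b + c + d)"
        using 2 by (simp add: eval_nat_numeral algebra_simps)
      finally have "c ^ 5 = 1" using s by (intro root_of_unity_5) simp
      moreover have "a ^ 5 = (c ^ 5)\<^sup>2" using 2 by (simp flip: power_mult)
      ultimately show ?thesis by simp
    qed
  qed
  have "a * b = 1 \<or> a * c = 1 \<or> a * d = 1"
  proof (rule special_has_inverse)
    show "1 + a + b + c + d = 0" by (rule s)
    show "distinct [b, c, d]" using dist by simp
  qed (rule sp; use dist in auto)+
  thus ?thesis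
  proof (elim disjE)
    assume "a * b = 1"
    show ?thesis by (rule *[OF s dist sp \<open>a * b = 1\<close>])
  next
    assume "a * c = 1"
    show ?thesis
    proof (rule *)
      show "1 + a + c + b + d = 0" using s by (simp add: add_ac)
      show "distinct [a, c, b, d]" using dist by auto
      fix x y assume "{x, y} \<subseteq> {a, c, b, d}" "x \<noteq> y"
      thus "y = x\<^sup>2 \<or> x = y\<^sup>2 \<or> x * y = 1" by (intro sp) auto
    qed fact
  next
    assume "a * d = 1"
    show ?thesis
    proof (rule *)
      show "1 + a + d + b + c = 0" using s by (simp add: add_ac)
      show "distinct [a, d, b, c]" using dist by auto
      fix x y assume "{x, y} \<subseteq> {a, d, b, c}" "x \<noteq> y"
      thus "y = x\<^sup>2 \<or> x = y\<^sup>2 \<or> x * y = 1" by (intro sp) auto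
    qed fact
  qed
qed

context dephased_hadamard_5 begin

text \<open>Any two entries of a core row are related as in \<open>core_pair_special\<close>, so the
  row satisfies the hypotheses of \<open>special_fifth_root\<close>. The distinctness assumptions
  are met later by dephasing a spectral matrix at other positions.\<close>

lemma core_fifth_root:
  assumes distinct_rows: "\<And>i j j'. i \<in> I - {i0} \<Longrightarrow> j \<in> J \<Longrightarrow> j' \<in> J \<Longrightarrow> j \<noteq> j' \<Longrightarrow> h i j \<noteq> h i j'"
    and distinct_cols: "\<And>i i' j. i \<in> I \<Longrightarrow> i' \<in> I \<Longrightarrow> j \<in> J - {j0} \<Longrightarrow> i \<noteq> i' \<Longrightarrow> h i j \<noteq> h i' j"
    and i: "i \<in> I - {i0}" and j: "j \<in> J - {j0}"
  shows "h i j ^ 5 = 1"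
proof -
  interpret T: dephased_hadamard_5 J I "\<lambda>j i. h i j" j0 i0 by (rule transposed)
  have special: "h i k' = (h i k)\<^sup>2 \<or> h i k = (h i k')\<^sup>2 \<or> h i k * h i k' = 1"
    if k: "k \<in> J - {j0}" "k' \<in> J - {j0}" "k \<noteq> k'" for k k'
  proof -
    have "card (I - {i0, i}) = 3" using card_rows i i0 by (subst card_Diff_subset) auto
    then obtain i' where i': "i' \<in> I" "i' \<noteq> i0" "i' \<noteq> i"
      by (metis Diff_iff card.empty ex_in_conv insertCI zero_neq_numeral)
    obtain s t where I: "I = {i0, i, i', s, t}" "distinct [i0, i, i', s, t]"
      using card_5_split[OF card_rows, of i0 i i'] i i' i0 by auto
    show ?thesis
    proof (rule core_pair_special)
      show "1 + h i k + h i' k + h s k + h t k = 0" "1 + h i k' + h i' k' + h s k' + h t k' = 0"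
        using T.row_sum[of k] T.row_sum[of k'] row0[of k] row0[of k'] k I by (auto simp: add_ac)
      show "distinct [h i' k, h s k, h t k]" "distinct [h i' k', h s k', h t k']"
        using distinct_cols I k by auto
      show "h i k \<noteq> 1" "h i k' \<noteq> 1" "h i k \<noteq> h i k'"
        using core_neq_1 i k distinct_rows by auto
      fix c d assume "(c, d) \<in> {(h i' k, h i' k'), (h s k, h s k'), (h t k, h t k')}"
      thus "(h i k * d = h i k' \<or> h i k' = c \<or> c = h i k * d) \<and> (h i k' * c = h i k \<or> h i k = d
          \<or> d = h i k' * c)"
        using minor_relations[OF i _ _ k] I by auto
    qed (use unit i k I in auto)
  qed
  have "card (J - {j0, j}) = 3" using card_cols j j0 by (subst card_Diff_subset) auto
  then obtain j' where j': "j' \<in> J" "j' \<noteq> j0" "j' \<noteq> j"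
    by (metis Diff_iff card.empty ex_in_conv insertCI zero_neq_numeral)
  obtain s t where J: "J = {j0, j, j', s, t}" "distinct [j0, j, j', s, t]"
    using card_5_split[OF card_cols, of j0 j j'] j j' j0 by auto
  show ?thesis
  proof (rule special_fifth_root)
    show "1 + h i j + h i j' + h i s + h i t = 0"
      using row_sum[OF i] J col0[of i] i by (simp add: add_ac)
    show "distinct [h i j, h i j', h i s, h i t]"
      using distinct_rows[OF i] J by auto
    fix x y assume xy: "{x, y} \<subseteq> {h i j, h i j', h i s, h i t}" "x \<noteq> y"
    have "{h i j, h i j', h i s, h i t} = h i ` (J - {j0})" using J by auto
    hence "x \<in> h i ` (J - {j0})" "y \<in> h i ` (J - {j0})" using xy(1) by auto
    then obtain k k' where "k \<in> J - {j0}" "k' \<in> J - {j0}" "x = h i k" "y = h i k'" by blast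
    thus "y = x\<^sup>2 \<or> x = y\<^sup>2 \<or> x * y = 1" using special xy by auto
  qed
qed

end

section \<open>Exponentials and orthogonality relations\<close>

lemma exponential_eq_cis: "exponential \<xi> x = cis (2 * pi * (\<xi> * x))"
  by (simp add: exponential_def cis_conv_exp mult_ac)

lemma exponential_add_freq: "exponential (a + b) x = exponential a x * exponential b x"
  by (simp add: exponential_eq_cis cis_mult algebra_simps)

lemma exponential_add: "exponential a (x + y) = exponential a x * exponential a y"
  by (simp add: exponential_eq_cis cis_mult algebra_simps)

lemma cmod_exponential [simp]: "cmod (exponential a x) = 1"
  by (simp add: exponential_eq_cis)

lemma exponential_nonzero [simp]: "exponential a x \<noteq> 0"
  using cmod_exponential[of a x] by (metis norm_zero zero_neq_one)

lemma cnj_exponential: "cnj (exponential a x) = exponential (- a) x"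
  by (simp add: exponential_eq_cis cis_cnj)

lemma exponential_zero [simp]: "exponential 0 x = 1" "exponential a 0 = 1"
  by (simp_all add: exponential_eq_cis)

lemma exponential_eq_1_iff: "exponential a x = 1 \<longleftrightarrow> a * x \<in> \<int>"
proof -
  have "exponential a x = 1 \<longleftrightarrow> (\<exists>n::int. 2 * pi * (a * x) = of_int (2 * n) * pi)"
    by (simp add: exponential_def exp_eq_1 mult_ac)
  also have "\<dots> \<longleftrightarrow> a * x \<in> \<int>" by (auto simp: Ints_def mult_ac)
  finally show ?thesis .
qed

lemma exponential_eq_neg_1_iff: "exponential a x = -1 \<longleftrightarrow> (\<exists>n::int. a * x = of_int n + 1 / 2)"
proof -
  have "exponential a x = -1 \<longleftrightarrow> cis (2 * pi * (a * x - 1 / 2)) = 1"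
    by (simp add: exponential_eq_cis algebra_simps flip: cis_divide)
       (auto simp: minus_equation_iff)
  also have "\<dots> \<longleftrightarrow> a * x - 1 / 2 \<in> \<int>"
    using exponential_eq_1_iff[of "a * x - 1 / 2" 1] by (simp add: exponential_eq_cis)
  also have "\<dots> \<longleftrightarrow> (\<exists>n::int. a * x = of_int n + 1 / 2)"
    by (auto simp: Ints_def algebra_simps)
  finally show ?thesis .
qed

lemma exponential_power: "exponential a x ^ n = exponential a (real n * x)"
  by (simp only: exponential_eq_cis Complex.DeMoivre mult_ac)

text \<open>Orthogonality of the rows says that the scaled adjoint is a right inverse, and a right
  inverse of a square matrix is also a left inverse. The type \<open>'n\<close> serves to index the
  matrices.\<close>

lemma orthogonal_columns:
  fixes h :: "'a \<Rightarrow> 'b \<Rightarrow> complex"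
  assumes card: "card I = CARD('n::finite)" "card J = CARD('n)"
    and unit: "\<And>i j. i \<in> I \<Longrightarrow> j \<in> J \<Longrightarrow> cmod (h i j) = 1"
    and rows: "\<And>i i'. i \<in> I \<Longrightarrow> i' \<in> I \<Longrightarrow> i \<noteq> i' \<Longrightarrow> (\<Sum>j\<in>J. cnj (h i j) * h i' j) = 0"
    and j: "j \<in> J" "j' \<in> J" "j \<noteq> j'"
  shows "(\<Sum>i\<in>I. cnj (h i j) * h i j') = 0"
proof -
  have "finite I" "finite J"
    using card by (metis card.infinite finite_UNIV_card_ge_0 finite less_irrefl)+
  then obtain f g where f: "bij_betw f (UNIV :: 'n set) I" and g: "bij_betw g (UNIV :: 'n set) J"
    using card by (metis finite finite_same_card_bij)
  let ?n = "of_nat CARD('n) :: complex"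
  define M :: "complex^'n^'n" where "M = (\<chi> r s. h (f r) (g s))"
  define N :: "complex^'n^'n" where "N = (\<chi> s r. cnj (h (f r) (g s)) / ?n)"
  have fI: "f r \<in> I" and gJ: "g s \<in> J" for r s using f g by (auto simp: bij_betw_def)
  have "(M ** N) $ r $ r' = (if r = r' then 1 else 0)" for r r'
  proof -
    have "(M ** N) $ r $ r' = (\<Sum>s\<in>UNIV. cnj (h (f r') (g s)) * h (f r) (g s)) / ?n"
      by (simp add: M_def N_def matrix_matrix_mult_def sum_divide_distrib mult_ac)
    also have "(\<Sum>s\<in>UNIV. cnj (h (f r') (g s)) * h (f r) (g s))
        = (\<Sum>j\<in>J. cnj (h (f r') j) * h (f r) j)"
      by (rule sum.reindex_bij_betw[OF g])
    also have "\<dots> = (if r = r' then ?n else 0)"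
    proof (cases "r = r'")
      case True
      have "(\<Sum>j\<in>J. cnj (h (f r) j) * h (f r) j) = (\<Sum>j\<in>J. 1)"
        by (rule sum.cong) (auto simp: mult.commute fI unit simp flip: complex_norm_square)
      thus ?thesis using True card by simp
    next
      case False
      hence "f r' \<noteq> f r" using f by (auto simp: bij_betw_def inj_def)
      thus ?thesis using rows[of "f r'" "f r"] fI False by simp
    qed
    finally show ?thesis by simp
  qed
  hence "M ** N = mat 1" by (simp add: vec_eq_iff mat_def)
  hence NM: "N ** M = mat 1" by (simp add: matrix_left_right_inverse)
  obtain s s' where s: "j = g s" "j' = g s'" using g j by (auto simp: bij_betw_def)
  have "s \<noteq> s'" using s j by auto
  hence "0 = (N ** M) $ s $ s'" by (simp add: NM mat_def)
  also have "\<dots> = (\<Sum>r\<in>UNIV. cnj (h (f r) j) * h (f r) j') / ?n"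
    by (simp add: M_def N_def s matrix_matrix_mult_def sum_divide_distrib)
  also have "(\<Sum>r\<in>UNIV. cnj (h (f r) j) * h (f r) j') = (\<Sum>i\<in>I. cnj (h i j) * h i j')"
    by (rule sum.reindex_bij_betw[OF f])
  finally show ?thesis by simp
qed

text \<open>The matrix with entries \<open>exponential \<theta> k\<close>, for
  \<open>\<theta>\<close> in \<open>L\<close> and \<open>k\<close> in \<open>A\<close>, is a complex
  Hadamard matrix of order \<open>p\<close>.\<close>

definition spectral_pair :: "nat \<Rightarrow> real set \<Rightarrow> int set \<Rightarrow> bool" where
  "spectral_pair p L A \<longleftrightarrow> card L = p \<and> card A = p \<and>
     (\<forall>\<theta>\<in>L. \<forall>\<theta>'\<in>L. \<theta> \<noteq> \<theta>' \<longrightarrow> (\<Sum>k\<in>A. exponential (\<theta>' - \<theta>) (of_int k)) = 0)"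

lemma exponential_cnj_mult:
  "cnj (exponential a x) * exponential b x = exponential (b - a) x"
  by (simp add: cnj_exponential flip: exponential_add_freq)

lemma spectral_pair_columns:
  assumes "spectral_pair p L A" "p = CARD('n::finite)" and a: "a \<in> A" "b \<in> A" "a \<noteq> b"
  shows "(\<Sum>\<theta>\<in>L. exponential (\<theta> - \<theta>0) (of_int a - of_int b)) = 0"
proof -
  have *: "(\<Sum>\<theta>\<in>L. cnj (exponential \<theta> (of_int b)) * exponential \<theta> (of_int a)) = 0"
    by (rule orthogonal_columns[where 'n = 'n and J = A])
       (use assms in \<open>auto simp: spectral_pair_def exponential_cnj_mult\<close>)
  have "(\<Sum>\<theta>\<in>L. exponential (\<theta> - \<theta>0) (of_int a - of_int b)) =
    (\<Sum>\<theta>\<in>L. exponential (- \<theta>0) (of_int a - of_int b) * (cnj (exponential \<theta> (of_int b)) *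
        exponential \<theta> (of_int a)))"
    by (rule sum.cong) (auto simp: exponential_eq_cis cis_cnj cis_mult algebra_simps)
  thus ?thesis using * by (simp flip: sum_distrib_left)
qed

text \<open>The exponent is bilinear in frequency and position, so normalising row
  \<open>\<theta>0\<close> and column \<open>a0\<close> to 1 just replaces both by
  differences.\<close>

lemma spectral_pair_dephased:
  assumes sp: "spectral_pair 5 L A" and "\<theta>0 \<in> L" "a0 \<in> A"
  shows "dephased_hadamard_5 L A (\<lambda>\<theta> a. exponential (\<theta> - \<theta>0) (of_int a - of_int a0)) \<theta>0 a0"
proof
  show "card L = 5" "card A = 5" using sp by (auto simp: spectral_pair_def)
  fix \<theta> \<theta>' assume t: "\<theta> \<in> L" "\<theta>' \<in> L" "\<theta> \<noteq> \<theta>'"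
  have "(\<Sum>a\<in>A. cnj (exponential (\<theta> - \<theta>0) (of_int a - of_int a0)) * exponential (\<theta>' - \<theta>0) (of_int a
      - of_int a0))
    = (\<Sum>a\<in>A. exponential (\<theta>' - \<theta>) (- of_int a0) * exponential (\<theta>' - \<theta>) (of_int a))"
    by (rule sum.cong) (auto simp: exponential_cnj_mult simp flip: exponential_add)
  also have "\<dots> = 0" using sp t by (auto simp: spectral_pair_def simp flip: sum_distrib_left)
  finally show "(\<Sum>a\<in>A. cnj (exponential (\<theta> - \<theta>0) (of_int a - of_int a0)) * exponential (\<theta>' - \<theta>0)
      (of_int a - of_int a0)) = 0" .
next
  fix a b assume ab: "a \<in> A" "b \<in> A" "a \<noteq> b"
  have "(\<Sum>\<theta>\<in>L. cnj (exponential (\<theta> - \<theta>0) (of_int a - of_int a0)) * exponential (\<theta> - \<theta>0) (of_int b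
      - of_int a0))
    = (\<Sum>\<theta>\<in>L. exponential (\<theta> - \<theta>0) (of_int b - of_int a))"
    by (rule sum.cong) (auto simp: exponential_eq_cis cis_cnj cis_mult algebra_simps)
  also have "\<dots> = 0" by (rule spectral_pair_columns[where 'n = 5, OF sp]) (use ab in auto)
  finally show "(\<Sum>\<theta>\<in>L. cnj (exponential (\<theta> - \<theta>0) (of_int a - of_int a0)) * exponential (\<theta> - \<theta>0)
      (of_int b - of_int a0)) = 0" .
qed (use assms in auto)

text \<open>The quotient of two entries in a row or column is itself a core entry of the matrix
  dephased at another position. Hence \<open>core_neq_1\<close>, available at every position, also
  yields the distinctness that \<open>core_fifth_root\<close> asks for.\<close>

lemma spectral_pair_5:
  assumes sp: "spectral_pair 5 L A" and \<theta>: "\<theta> \<in> L" "\<theta>' \<in> L" "\<theta> \<noteq> \<theta>'"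
    and ab: "a \<in> A" "b \<in> A" "a \<noteq> b"
  defines "z \<equiv> exponential (\<theta> - \<theta>') (of_int a - of_int b)"
  shows "z \<noteq> 1 \<and> z ^ 5 = 1"
proof
  have neq: "exponential (\<theta> - \<theta>') (of_int a - of_int b) \<noteq> 1"
    if "\<theta> \<in> L" "\<theta>' \<in> L" "\<theta> \<noteq> \<theta>'" "a \<in> A" "b \<in> A" "a \<noteq> b" for \<theta> \<theta>' a b
    using dephased_hadamard_5.core_neq_1[OF spectral_pair_dephased[OF sp that(2,5)]] that by auto
  thus "z \<noteq> 1" unfolding z_def using \<theta> ab by blast
  show "z ^ 5 = 1" unfolding z_def
  proof (rule dephased_hadamard_5.core_fifth_root[OF spectral_pair_dephased[OF sp \<theta>(2) ab(2)]])
    fix \<mu> j j' assume *: "\<mu> \<in> L - {\<theta>'}" "j \<in> A" "j' \<in> A" "j \<noteq> j'"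
    have "exponential (\<mu> - \<theta>') (of_int j - of_int b) =
      exponential (\<mu> - \<theta>') (of_int j' - of_int b) * exponential (\<mu> - \<theta>') (of_int j - of_int j')"
      by (simp flip: exponential_add)
    thus "exponential (\<mu> - \<theta>') (of_int j - of_int b) \<noteq> exponential (\<mu> - \<theta>') (of_int j' - of_int b)"
      using neq[of \<mu> \<theta>' j j'] * \<theta> by auto
  next
    fix \<mu> \<mu>' j assume *: "\<mu> \<in> L" "\<mu>' \<in> L" "j \<in> A - {b}" "\<mu> \<noteq> \<mu>'"
    have "exponential (\<mu> - \<theta>') (of_int j - of_int b) =
      exponential (\<mu>' - \<theta>') (of_int j - of_int b) * exponential (\<mu> - \<mu>') (of_int j - of_int b)"
      by (simp flip: exponential_add_freq)
    thus "exponential (\<mu> - \<theta>') (of_int j - of_int b) \<noteq> exponential (\<mu>' - \<theta>') (of_int j - of_int b)"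
      using neq[of \<mu> \<mu>' j b] * ab by auto
  qed (use \<theta> ab in auto)
qed

section \<open>Common tilings of the integers\<close>

text \<open>The direct sum decomposition of the integers into \<open>A\<close> and
  \<open>T\<close>.\<close>

definition int_tiles :: "int set \<Rightarrow> int set \<Rightarrow> bool" where
  "int_tiles T A \<longleftrightarrow> (\<forall>n. \<exists>!a. a \<in> A \<and> n - a \<in> T)"

text \<open>For fixed \<open>n\<close> the quotients \<open>(n - a) div D\<close> are pairwise
  incongruent modulo \<open>p\<close>. There are \<open>p\<close> of them, so exactly one is
  divisible by \<open>p\<close>. For \<open>D\<close> a power of \<open>p\<close> the condition on
  \<open>t\<close> says that one base-p digit is zero.\<close>

lemma int_tiles_residues:
  fixes D :: int and p :: nat
  assumes D: "D > 0" and p: "p > 0" and card: "card A = p"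
    and diff: "\<And>a b. a \<in> A \<Longrightarrow> b \<in> A \<Longrightarrow> a \<noteq> b \<Longrightarrow> \<exists>m. a - b = D * m \<and> \<not> int p dvd m"
  shows "int_tiles {t. int p dvd t div D} A"
  unfolding int_tiles_def
proof
  fix n :: int
  have fin: "finite A" using p card by (metis card.infinite less_irrefl)
  define q where "q a = (n - a) div D" for a
  have q_diff: "\<not> int p dvd q b - q a" if "a \<in> A" "b \<in> A" "a \<noteq> b" for a b
  proof -
    have "\<exists>m. a - b = D * m \<and> \<not> int p dvd m" by (rule diff) (use that in auto)
    then obtain m where m: "a - b = D * m" "\<not> int p dvd m" by blast
    hence "n - b = D * m + (n - a)" by simp
    hence "q b = (D * m + (n - a)) div D" by (simp only: q_def)
    \<comment> \<open>The difference is an exact multiple of \<open>D\<close>, so the floor produces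
      no carry.\<close>
    also have "\<dots> = q a + m" unfolding q_def by (subst div_mult_self4) (use D in auto)
    finally have "q b = q a + m" .
    thus ?thesis using m by simp
  qed
  have inj: "inj_on (\<lambda>a. q a mod int p) A"
  proof (rule inj_onI, rule ccontr)
    fix a b assume "a \<in> A" "b \<in> A" "q a mod int p = q b mod int p" "a \<noteq> b"
    thus False using q_diff[of b a] by (simp add: mod_eq_dvd_iff)
  qed
  have "(\<lambda>a. q a mod int p) ` A \<subseteq> {0..<int p}" using p by auto
  moreover have "card ((\<lambda>a. q a mod int p) ` A) = card {0..<int p}"
    using card_image[OF inj] card by simp
  ultimately have "(\<lambda>a. q a mod int p) ` A = {0..<int p}"
    by (intro card_subset_eq) auto
  hence "0 \<in> (\<lambda>a. q a mod int p) ` A" using p by simp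
  then obtain a where a: "a \<in> A" "q a mod int p = 0" by fastforce
  show "\<exists>!a. a \<in> A \<and> n - a \<in> {t. int p dvd t div D}"
  proof (intro ex1I)
    show "a \<in> A \<and> n - a \<in> {t. int p dvd t div D}"
      using a by (auto simp: q_def)
    fix b assume "b \<in> A \<and> n - b \<in> {t. int p dvd t div D}"
    hence "b \<in> A" "q b mod int p = 0" by (auto simp: q_def)
    thus "b = a" using inj_onD[OF inj, of b a] a by simp
  qed
qed

text \<open>Here \<open>\<theta> * x = R / p\<close> and \<open>\<theta> * y = S / p\<close> with
  \<open>R\<close> and \<open>S\<close> prime to \<open>p\<close>. Eliminating
  \<open>\<theta>\<close> gives \<open>R * y = S * x\<close>, where \<open>R\<close> and
  \<open>S\<close> do not contribute to the valuation.\<close>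

lemma root_of_unity_multiplicity:
  fixes x y :: int and p :: nat
  assumes p: "prime p"
    and x: "exponential \<theta> (of_int x) ^ p = 1" "exponential \<theta> (of_int x) \<noteq> 1"
    and y: "exponential \<theta> (of_int y) ^ p = 1" "exponential \<theta> (of_int y) \<noteq> 1"
  shows "multiplicity (int p) x = multiplicity (int p) y"
proof -
  have p0: "real p \<noteq> 0" "prime (int p)" using p by (auto dest: prime_gt_0_nat)
  have ex: "\<exists>R. \<theta> * (real p * of_int z) = of_int R \<and> \<not> int p dvd R"
    if "exponential \<theta> (of_int z) ^ p = 1" "exponential \<theta> (of_int z) \<noteq> 1" for z :: int
  proof -
    have "\<theta> * (real p * of_int z) \<in> \<int>" "\<theta> * of_int z \<notin> \<int>"
      using that by (auto simp: exponential_power exponential_eq_1_iff)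
    then obtain R where R: "\<theta> * (real p * of_int z) = of_int R" by (auto simp: Ints_def)
    have "\<not> int p dvd R"
    proof
      assume "int p dvd R"
      then obtain k where "R = int p * k" ..
      hence "real p * (\<theta> * of_int z) = real p * of_int k" using R by (simp add: mult_ac)
      hence "\<theta> * of_int z = of_int k" using p0 by simp
      thus False using \<open>\<theta> * of_int z \<notin> \<int>\<close> by simp
    qed
    thus ?thesis using R by blast
  qed
  obtain R where R: "\<theta> * (real p * of_int x) = of_int R" "\<not> int p dvd R" using ex x by blast
  obtain S where S: "\<theta> * (real p * of_int y) = of_int S" "\<not> int p dvd S" using ex y by blast
  have nz: "x \<noteq> 0" "y \<noteq> 0" "R \<noteq> 0" "S \<noteq> 0" using x y R S by auto
  have "real_of_int (R * y) = real_of_int (S * x)"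
    using R(1) S(1) by (metis (no_types, opaque_lifting) mult.assoc mult.commute of_int_mult)
  hence "R * y = S * x" by (simp only: of_int_eq_iff)
  hence "multiplicity (int p) (R * y) = multiplicity (int p) (S * x)" by simp
  thus ?thesis using R S nz p0
    by (simp add: prime_elem_multiplicity_mult_distrib not_dvd_imp_multiplicity_0)
qed

text \<open>For two or three unit numbers a single vanishing sum, normalised at \<open>b\<close>,
  already forces roots of unity; order five uses the whole matrix.\<close>

lemma spectral_pair_2_3_5:
  assumes p: "p \<in> {2, 3, 5}" and sp: "spectral_pair p L A"
    and \<theta>: "\<theta> \<in> L" "\<theta>' \<in> L" "\<theta> \<noteq> \<theta>'" and ab: "a \<in> A" "b \<in> A" "a \<noteq> b"
  shows "exponential (\<theta> - \<theta>') (of_int (a - b)) \<noteq> 1 \<and> exponential (\<theta> - \<theta>') (of_int (a - b)) ^ p = 1"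
proof -
  have "(\<Sum>k\<in>A. exponential (\<theta> - \<theta>') (of_int k)) = 0" using sp \<theta> by (auto simp: spectral_pair_def)
  hence "0 = (\<Sum>k\<in>A. exponential (\<theta> - \<theta>') (of_int k)) * exponential (\<theta> - \<theta>') (- of_int b)" by simp
  also have "\<dots> = (\<Sum>k\<in>A. exponential (\<theta> - \<theta>') (of_int (k - b)))"
    by (simp add: sum_distrib_right flip: exponential_add)
  finally have sum: "(\<Sum>k\<in>A. exponential (\<theta> - \<theta>') (of_int (k - b))) = 0" by simp
  define z where "z = exponential (\<theta> - \<theta>') (of_int (a - b))"
  have "card A = p" using sp by (simp add: spectral_pair_def)
  hence cd: "card (A - {a, b}) = p - 2" and fin: "finite A" using ab p
    by (auto simp: card_Diff_subset intro!: card_ge_0_finite)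
  from p consider "p = 2" | "p = 3" | "p = 5" by auto
  thus ?thesis
  proof cases
    case 1
    hence "A = {a, b}" using card_seteq[of A "{a, b}"] \<open>card A = p\<close> ab fin by auto
    hence "z = -1" using sum ab by (simp add: z_def eq_neg_iff_add_eq_0)
    thus ?thesis using 1 unfolding z_def[symmetric] by simp
  next
    case 2
    then obtain c where c: "A - {a, b} = {c}" using cd by (auto simp: card_1_singleton_iff)
    hence A: "A = {a, b, c}" "c \<noteq> a" "c \<noteq> b" using ab by auto
    define w where "w = exponential (\<theta> - \<theta>') (of_int (c - b))"
    have s: "1 + z + w = 0" using sum A ab by (simp add: z_def w_def add_ac)
    have u: "cmod z = 1" "cmod w = 1" by (simp_all add: z_def w_def)
    have "1 + inverse z + inverse w = cnj (1 + z + w)" using u by (simp add: unit_cnj)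
    hence "1 + inverse z + inverse w = 0" by (simp add: s)
    moreover have "z \<noteq> 0" "w \<noteq> 0" using u by auto
    hence "z * w + w + z = z * w * (1 + inverse z + inverse w)" by (simp add: field_simps)
    ultimately have "z * w + w + z = 0" by simp
    hence "z * w = 1" using s by (metis add.assoc add.commute add_left_cancel)
    moreover have "z * (1 + z + w) = 0" using s by simp
    ultimately have "1 + z + z\<^sup>2 = 0" by (simp add: algebra_simps power2_eq_square)
    hence "z ^ 3 = 1" by (rule root_of_unity_3)
    moreover have "z \<noteq> 1" using \<open>1 + z + z\<^sup>2 = 0\<close> by auto
    ultimately show ?thesis using 2 unfolding z_def[symmetric] by simp
  next
    case 3
    thus ?thesis using spectral_pair_5 sp \<theta> ab by fastforce
  qed
qed

lemma common_tiling_2_3_5: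
  assumes p: "p \<in> {2, 3, 5 :: nat}"
  shows "\<exists>T. \<forall>A. spectral_pair p L A \<longrightarrow> int_tiles T A"
proof (cases "\<exists>A. spectral_pair p L A")
  case True
  have pp: "prime p" and p2: "p \<ge> 2" using p by auto
  from True obtain A0 where A0: "spectral_pair p L A0" by blast
  hence "card L \<ge> 2" "card A0 \<ge> 2" using p2 by (auto simp: spectral_pair_def)
  then obtain \<theta> \<theta>' a0 b0 where \<theta>: "\<theta> \<in> L" "\<theta>' \<in> L" "\<theta> \<noteq> \<theta>'"
    and a0: "a0 \<in> A0" "b0 \<in> A0" "a0 \<noteq> b0"
    by (metis card_2_iff ex_card insert_subset)
  \<comment> \<open>Read off from an arbitrary \<open>A0\<close>. The fixed frequency difference of
    \<open>\<theta>\<close> and \<open>\<theta>'\<close> carries this valuation over to every other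
    \<open>A\<close>.\<close>
  define e where "e = multiplicity (int p) (a0 - b0)"
  have "int_tiles {t. int p dvd t div (int p ^ e)} A" if A: "spectral_pair p L A" for A
  proof (rule int_tiles_residues)
    show "0 < int p ^ e" "0 < p" using p2 by auto
    show "card A = p" using A by (simp add: spectral_pair_def)
    fix a b assume ab: "a \<in> A" "b \<in> A" "a \<noteq> b"
    have "multiplicity (int p) (a - b) = e" unfolding e_def
      using spectral_pair_2_3_5[OF p A \<theta> ab] spectral_pair_2_3_5[OF p A0 \<theta> a0]
      by (intro root_of_unity_multiplicity[OF pp]) blast+
    moreover have "a - b \<noteq> 0" "\<not> is_unit (int p)" using ab pp by auto
    ultimately show "\<exists>m. a - b = int p ^ e * m \<and> \<not> int p dvd m"
      by (metis multiplicity_decompose')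
  qed
  thus ?thesis by blast
qed auto

lemma four_units_sum_zero:
  assumes "cmod x = 1" "cmod y = 1" "cmod z = 1" and s: "1 + x + y + z = 0"
  shows "x = -1 \<or> y = -1 \<or> z = -1"
proof -
  have nz: "x \<noteq> 0" "y \<noteq> 0" "z \<noteq> 0" using assms by auto
  have "1 + inverse x + inverse y + inverse z = cnj (1 + x + y + z)"
    using assms(1-3) by (simp add: unit_cnj)
  hence "1 + inverse x + inverse y + inverse z = 0" by (simp add: s)
  hence "0 = x * y * z * (1 + inverse x + inverse y + inverse z)" by simp
  also have "\<dots> = x * y * z + y * z + x * z + x * y" using nz by (simp add: field_simps)
  \<comment> \<open>The second bracket is \<open>x * y * z\<close> times the conjugate of the first,
    and the two together are a product of three factors.\<close>
  finally have "(1 + x + y + z) + (x * y * z + y * z + x * z + x * y) = 0" using s by simp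
  hence "(1 + x) * (1 + y) * (1 + z) = 0" by (simp add: algebra_simps)
  thus ?thesis by (auto simp: eq_neg_iff_add_eq_0 add.commute)
qed

lemma multiplicity_uminus: "multiplicity p (- x) = multiplicity p x" for p x :: int
  using multiplicity_times_unit_right[of "-1" p x] by simp

text \<open>The sum of two odd numbers is even. This strict gain, special to the prime 2, is what
  separates the two valuations for \<open>p = 4\<close>.\<close>

lemma multiplicity_2_add_eq:
  fixes x y :: int
  assumes "multiplicity 2 x = multiplicity 2 y" "x \<noteq> 0" "y \<noteq> 0" "x + y \<noteq> 0"
  shows "multiplicity 2 (x + y) > multiplicity 2 x"
proof -
  define k where "k = multiplicity 2 x"
  obtain u where u: "x = 2 ^ k * u" "odd u"
    unfolding k_def by (rule multiplicity_decompose'[of x 2]) (use assms in auto)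
  obtain v where v: "y = 2 ^ k * v" "odd v"
    unfolding k_def assms(1) by (rule multiplicity_decompose'[of y 2]) (use assms in auto)
  obtain w where "u + v = 2 * w" using u v by (metis evenE odd_even_add)
  hence "x + y = 2 ^ Suc k * w" by (simp add: u v flip: distrib_left)
  hence "2 ^ Suc k dvd x + y" by simp
  hence "Suc k \<le> multiplicity 2 (x + y)" using assms by (intro multiplicity_geI) auto
  thus ?thesis by (simp add: k_def)
qed

lemma multiplicity_2_diff:
  fixes x y :: int
  assumes "multiplicity 2 x < multiplicity 2 y" "x \<noteq> 0" "y \<noteq> 0"
  shows "multiplicity 2 (x - y) = multiplicity 2 x"
  using multiplicity_sum_lt[of 2 x "- y"] assms by (simp add: multiplicity_uminus)

text \<open>\<open>T\<close> consists of the integers whose binary digits at positions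
  \<open>f\<close> and \<open>e\<close> are both zero. For given \<open>n\<close>, digit
  \<open>f\<close> of \<open>n - x\<close> tells the pair \<open>a\<close>, \<open>b\<close> from
  the pair \<open>c\<close>, \<open>d\<close>, and digit \<open>e\<close> tells the two members of a
  pair apart.\<close>

lemma int_tiles_two_pairs:
  fixes a b c d :: int
  assumes fe: "f < e" and A: "A = {a, b, c, d}"
    and ab: "a - b = 2 ^ e * m" "odd m" and cd: "c - d = 2 ^ e * m'" "odd m'"
    and ac: "a - c = 2 ^ f * k" "odd k"
  shows "int_tiles {t. even (t div 2 ^ f) \<and> even (t div 2 ^ e)} A"
  unfolding int_tiles_def
proof
  fix n :: int
  define F where "F x = even ((n - x) div 2 ^ f)" for x :: int
  define E where "E x = even ((n - x) div 2 ^ e)" for x :: int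
  have shift: "(n - y) div 2 ^ g = (n - x) div 2 ^ g + q" if "x - y = 2 ^ g * q"
      for x y q :: int and g
  proof -
    have "n - y = 2 ^ g * q + (n - x)" using that by simp
    hence "(n - y) div 2 ^ g = (2 ^ g * q + (n - x)) div 2 ^ g" by (simp only:)
    also have "\<dots> = (n - x) div 2 ^ g + q" by (subst div_mult_self4) auto
    finally show ?thesis .
  qed
  \<comment> \<open>A multiple of \<open>2 ^ e\<close> is an even multiple of \<open>2 ^ f\<close>,
    so digit \<open>f\<close> agrees within each pair.\<close>
  have fe': "(2::int) ^ e = 2 ^ f * (2 * 2 ^ (e - f - 1))"
    using fe by (simp flip: power_add power_Suc)
  have "F y = F x" if "x - y = 2 ^ e * q" for x y q :: int
  proof -
    have "x - y = 2 ^ f * (2 * (2 ^ (e - f - 1) * q))" unfolding that fe' by (simp only: mult.assoc)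
    from shift[OF this] show ?thesis by (simp add: F_def)
  qed
  hence "F b = F a" "F d = F c" using ab(1) cd(1) by blast+
  moreover have "F c \<longleftrightarrow> \<not> F a" using shift[OF ac(1)] ac(2) by (simp add: F_def)
  moreover have "E b \<longleftrightarrow> \<not> E a" "E d \<longleftrightarrow> \<not> E c"
    using shift[OF ab(1)] shift[OF cd(1)] ab(2) cd(2) by (simp_all add: E_def)
  ultimately have "\<exists>!x. x \<in> A \<and> F x \<and> E x" unfolding A by (cases "F a"; cases "E a"; cases "E c";
      auto)
  thus "\<exists>!x. x \<in> A \<and> n - x \<in> {t. even (t div 2 ^ f) \<and> even (t div 2 ^ e)}"
    by (simp add: F_def E_def)
qed

text \<open>An intrinsic description of a difference set: the next two lemmas show that, for
  \<open>\<theta>0\<close> in \<open>L\<close> and every \<open>A\<close> with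
  \<open>spectral_pair 4 L A\<close>, these are exactly the 2-adic valuations of the nonzero
  differences of \<open>A\<close>.\<close>

definition half_valuations :: "real set \<Rightarrow> real \<Rightarrow> nat set" where
  "half_valuations L \<theta>0 =
     {multiplicity 2 n |n \<theta>. \<theta> \<in> L - {\<theta>0} \<and> exponential (\<theta> - \<theta>0) (of_int n) = -1}"

text \<open>Orthogonality of columns \<open>a\<close> and \<open>b\<close> is a vanishing sum of
  four unit numbers, one of them 1, so some frequency takes the value -1 at
  \<open>a - b\<close>.\<close>

lemma spectral_pair_4_valuation:
  assumes sp: "spectral_pair 4 L A" and \<theta>0: "\<theta>0 \<in> L" and ab: "a \<in> A" "b \<in> A" "a \<noteq> b"
  shows "multiplicity 2 (a - b) \<in> half_valuations L \<theta>0"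
proof -
  have cL: "card L = 4" using sp by (simp add: spectral_pair_def)
  hence "finite L" by (intro card_ge_0_finite) simp
  hence "card (L - {\<theta>0}) = 3" using cL \<theta>0 by simp
  then obtain r s t where rst: "L - {\<theta>0} = {r, s, t}" "r \<noteq> s" "s \<noteq> t" "r \<noteq> t"
    by (auto simp: card_3_iff)
  hence L: "L = {\<theta>0, r, s, t}" "distinct [\<theta>0, r, s, t]" using \<theta>0 by auto
  have "(\<Sum>\<theta>\<in>L. exponential (\<theta> - \<theta>0) (of_int a - of_int b)) = 0"
    by (rule spectral_pair_columns[where 'n = 4, OF sp]) (use ab in auto)
  hence "1 + exponential (r - \<theta>0) (of_int (a - b)) + exponential (s - \<theta>0) (of_int (a - b))
    + exponential (t - \<theta>0) (of_int (a - b)) = 0" using L by (simp add: add_ac)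
  from four_units_sum_zero[OF _ _ _ this]
  have "\<exists>\<theta>\<in>{r, s, t}. exponential (\<theta> - \<theta>0) (of_int (a - b)) = -1" by auto
  thus ?thesis unfolding half_valuations_def rst(1) by blast
qed

text \<open>A frequency realising \<open>v\<close> sums to zero over \<open>A\<close>, so its four
  values form two antipodal pairs. Positions with antipodal values differ by an integer at which the
  exponential is -1, and all such integers have valuation \<open>v\<close>.\<close>

lemma spectral_pair_4_matching:
  assumes sp: "spectral_pair 4 L A" and \<theta>0: "\<theta>0 \<in> L" and v: "v \<in> half_valuations L \<theta>0"
  shows "\<exists>a b c d. A = {a, b, c, d} \<and> distinct [a, b, c, d] \<and>
    multiplicity 2 (a - b) = v \<and> multiplicity 2 (c - d) = v"
proof -
  obtain n \<theta> where \<theta>: "\<theta> \<in> L - {\<theta>0}" "exponential (\<theta> - \<theta>0) (of_int n) = -1" "v = multiplicity 2 n"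
    using v by (auto simp: half_valuations_def)
  have val: "multiplicity 2 x = v" if "exponential (\<theta> - \<theta>0) (of_int x) = -1" for x :: int
    using root_of_unity_multiplicity[of 2 "\<theta> - \<theta>0" x n] \<theta> that by simp
  define g where "g = (\<lambda>k::int. exponential (\<theta> - \<theta>0) (of_int k))"
  have g: "multiplicity 2 (x - y) = v" if "g x = - g y" for x y
  proof (rule val)
    have "g x = exponential (\<theta> - \<theta>0) (of_int (x - y)) * g y"
      unfolding g_def exponential_add[symmetric] by simp
    thus "exponential (\<theta> - \<theta>0) (of_int (x - y)) = -1"
      using that by (metis exponential_nonzero g_def mult_cancel_right mult_minus1)
  qed
  have cA: "card A = 4" using sp by (simp add: spectral_pair_def)
  hence fin: "finite A" by (intro card_ge_0_finite) simp
  have "A \<noteq> {}" using cA by auto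
  then obtain a where a: "a \<in> A" by blast
  hence "card (A - {a}) = 3" using cA fin by simp
  then obtain b c d where bcd: "A - {a} = {b, c, d}" "b \<noteq> c" "c \<noteq> d" "b \<noteq> d"
    by (auto simp: card_3_iff)
  hence A: "A = {a, b, c, d}" "distinct [a, b, c, d]" using a by auto
  have "(\<Sum>k\<in>A. g k) = 0" using sp \<theta> \<theta>0 by (auto simp: spectral_pair_def g_def)
  hence s: "g a + g b + g c + g d = 0" using A by (simp add: add_ac)
  have ng: "g x \<noteq> 0" "cmod (g x) = 1" for x by (simp_all add: g_def)
  have "1 + g b / g a + g c / g a + g d / g a = (g a + g b + g c + g d) / g a"
    using ng by (simp add: field_simps)
  hence "g b / g a = -1 \<or> g c / g a = -1 \<or> g d / g a = -1"
    using s by (intro four_units_sum_zero) (auto simp: norm_divide ng)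
  hence "g a = - g b \<or> g a = - g c \<or> g a = - g d"
    using ng by (auto simp: field_simps minus_equation_iff)
  moreover have "g a = - g b \<Longrightarrow> g c = - g d" "g a = - g c \<Longrightarrow> g b = - g d" "g a = - g d \<Longrightarrow> g b = - g c"
  proof -
    have "(g a + g b) + (g c + g d) = 0" "(g a + g c) + (g b + g d) = 0" "(g a + g d) + (g b
        + g c) = 0"
      using s by (simp_all add: add_ac)
    thus "g a = - g b \<Longrightarrow> g c = - g d" "g a = - g c \<Longrightarrow> g b = - g d" "g a = - g d \<Longrightarrow> g b = - g c"
      by (simp_all add: eq_neg_iff_add_eq_0)
  qed
  ultimately consider "g a = - g b" "g c = - g d" | "g a = - g c" "g b = - g d" | "g a
      = - g d" "g b = - g c"
    by blast
  thus ?thesis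
  proof cases
    case 1
    thus ?thesis using g A by (intro exI[of _ a] exI[of _ b] exI[of _ c] exI[of _ d]) auto
  next
    case 2
    thus ?thesis using g A by (intro exI[of _ a] exI[of _ c] exI[of _ b] exI[of _ d]) auto
  next
    case 3
    thus ?thesis using g A by (intro exI[of _ a] exI[of _ d] exI[of _ b] exI[of _ c]) auto
  qed
qed

text \<open>A pair of maximal 2-adic distance exponent is matched with the complementary pair, so the
  ultrametric inequality forces all remaining distances to agree; the two exponents are the extreme
  elements of a set depending on the spectrum alone.\<close>

lemma common_tiling_4: "\<exists>T. \<forall>A. spectral_pair 4 L A \<longrightarrow> int_tiles T A"
proof (cases "L = {}")
  case True
  thus ?thesis by (auto simp: spectral_pair_def)
next
  case False
  then obtain \<theta>0 where \<theta>0: "\<theta>0 \<in> L" by blast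
  define V where "V = half_valuations L \<theta>0"
  have "int_tiles {t. even (t div 2 ^ Min V) \<and> even (t div 2 ^ Max V)} A"
      if sp: "spectral_pair 4 L A" for A
  proof -
    let ?v = "\<lambda>x y :: int. multiplicity 2 (x - y)"
    have cA: "card A = 4" using sp by (simp add: spectral_pair_def)
    hence fin: "finite A" by (intro card_ge_0_finite) simp
    have val: "?v x y \<in> V" if "x \<in> A" "y \<in> A" "x \<noteq> y" for x y
      unfolding V_def by (rule spectral_pair_4_valuation[OF sp \<theta>0 that])
    have match: "\<exists>a b c d. A = {a, b, c, d} \<and> distinct [a, b, c, d] \<and> ?v a b = v \<and> ?v c d = v"
      if "v \<in> V" for v using spectral_pair_4_matching[OF sp \<theta>0] that by (simp add: V_def)
    have pair: "\<exists>x\<in>A. \<exists>y\<in>A. x \<noteq> y \<and> ?v x y = v" if v: "v \<in> V" for v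
    proof -
      obtain a b c d where "A = {a, b, c, d}" "distinct [a, b, c, d]" "?v a b = v"
        using match[OF v] by blast
      thus ?thesis by (intro bexI[of _ a] bexI[of _ b]) simp_all
    qed
    have "V \<subseteq> (\<lambda>(x, y). ?v x y) ` (A \<times> A)"
    proof
      fix v assume "v \<in> V"
      then obtain x y where "x \<in> A" "y \<in> A" "?v x y = v" using pair by blast
      thus "v \<in> (\<lambda>(x, y). ?v x y) ` (A \<times> A)" by (intro image_eqI[of _ _ "(x, y)"]) simp_all
    qed
    \<comment> \<open>The definition of \<open>V\<close> lets the integers range freely; the
      finiteness needed for \<open>Max\<close> and \<open>Min\<close> is inherited from
      \<open>A\<close>.\<close>
    hence finV: "finite V" using fin by (meson finite_SigmaI finite_imageI finite_subset)
    have "\<not> card A \<le> Suc 0" using cA by simp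
    then obtain x y where "x \<in> A" "y \<in> A" "x \<noteq> y" using card_le_Suc0_iff_eq[OF fin] by blast
    hence "V \<noteq> {}" using val by blast
    define e where "e = Max V"
    have "e \<in> V" using finV \<open>V \<noteq> {}\<close> by (simp add: e_def)
    then obtain a b c d where A: "A = {a, b, c, d}" "distinct [a, b, c, d]"
      and ab: "?v a b = e" and cd: "?v c d = e" using match by blast
    have le: "?v x y \<le> e" if "x \<in> A" "y \<in> A" "x \<noteq> y" for x y
      unfolding e_def using val[OF that] finV by simp
    have sym: "?v x y = ?v y x" for x y
      by (metis minus_diff_eq multiplicity_uminus)
    \<comment> \<open>Two differences of valuation \<open>e\<close> sharing an endpoint would
      combine to one of larger valuation, against maximality. So any third point has smaller
      valuation to the pair, and the same one to both ends.\<close>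
    have lt: "?v x z < e \<and> ?v y z = ?v x z" if "x \<in> A" "y \<in> A" "z \<in> A" "distinct [x, y, z]"
        "?v x y = e" for x y z
    proof -
      have "?v x z \<noteq> e"
      proof
        assume "?v x z = e"
        hence "?v y x < multiplicity 2 ((y - x) + (x - z))"
          using that sym[of y x] by (intro multiplicity_2_add_eq) auto
        thus False using le[of y z] that sym[of y x] by simp
      qed
      hence l: "?v x z < e" using le[of x z] that by fastforce
      have "multiplicity 2 ((x - z) - (x - y)) = ?v x z"
        using that l by (intro multiplicity_2_diff) auto
      thus ?thesis using l by simp
    qed
    define f where "f = ?v a c"
    have f: "f < e" "?v b c = f" using lt[of a b c] A ab by (auto simp: f_def)
    have "?v d a = f" using lt[of c d a] A cd sym[of c a] by (auto simp: f_def)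
    hence ad: "?v a d = f" using sym[of a d] by simp
    have "?v b d = f" using lt[of a b d] A ab ad by auto
    have vals: "?v a b = e" "?v c d = e" "?v a c = f" "?v b c = f" "?v a d = f" "?v b d = f"
      "?v b a = e" "?v d c = e" "?v c a = f" "?v c b = f" "?v d a = f" "?v d b = f"
      using ab cd f(2) ad \<open>?v b d = f\<close> sym f_def by metis+
    have "V \<subseteq> {e, f}"
    proof
      fix v assume "v \<in> V"
      then obtain x y where "x \<in> A" "y \<in> A" "x \<noteq> y" "?v x y = v" using pair by blast
      thus "v \<in> {e, f}"
        by (auto simp: A(1) vals)
    qed
    moreover have "f \<in> V" using val[of a c] A by (auto simp: f_def)
    ultimately have V: "V = {e, f}" using \<open>e \<in> V\<close> by blast
    hence "Min V = f" using f by simp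
    have dec: "\<exists>m. x - y = 2 ^ ?v x y * m \<and> odd m" if "x \<noteq> y" for x y :: int
      by (rule multiplicity_decompose'[of "x - y" 2]) (use that in auto)
    obtain m m' k where "a - b = 2 ^ e * m" "odd m" "c - d = 2 ^ e * m'" "odd m'" "a - c
        = 2 ^ f * k" "odd k"
      using dec[of a b] dec[of c d] dec[of a c] ab cd A by (auto simp: f_def)
    thus ?thesis unfolding \<open>Min V = f\<close> e_def[symmetric]
      by (intro int_tiles_two_pairs[OF \<open>f < e\<close> A(1)])
  qed
  thus ?thesis by blast
qed

lemma common_tiling:
  assumes "p \<in> {2, 3, 4, 5 :: nat}"
  shows "\<exists>T. \<forall>A. spectral_pair p L A \<longrightarrow> int_tiles T A"
  using assms common_tiling_2_3_5[of p L] common_tiling_4[of L] by auto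

section \<open>Uniqueness of Fourier coefficients\<close>

lemma continuous_on_exponential [continuous_intros]: "continuous_on S (exponential a)"
  unfolding exponential_def by (intro continuous_intros)

lemma borel_measurable_exponential [measurable]: "exponential a \<in> borel_measurable borel"
  by (intro borel_measurable_continuous_onI continuous_on_exponential)

text \<open>Trigonometric polynomials in the frequencies q Z. The inductive form turns closure under
  products and vanishing of integrals into inductions.\<close>

inductive trig_poly :: "real \<Rightarrow> (real \<Rightarrow> complex) \<Rightarrow> bool" for q where
  monomial: "trig_poly q (exponential (q * of_int n))"
| scale: "trig_poly q f \<Longrightarrow> trig_poly q (\<lambda>x. c * f x)"
| add: "trig_poly q f \<Longrightarrow> trig_poly q g \<Longrightarrow> trig_poly q (\<lambda>x. f x + g x)"

lemma trig_poly_const: "trig_poly q (\<lambda>x. c)"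
  using trig_poly.scale[OF trig_poly.monomial[of q 0], of c] by simp

lemma trig_poly_mult:
  assumes "trig_poly q f" "trig_poly q g"
  shows "trig_poly q (\<lambda>x. f x * g x)"
  using assms(1)
proof induction
  case (monomial n)
  show ?case using assms(2)
  proof induction
    case (monomial m)
    have "(\<lambda>x. exponential (q * of_int n) x * exponential (q * of_int m) x)
        = exponential (q * of_int (n + m))"
      by (simp add: fun_eq_iff algebra_simps flip: exponential_add_freq)
    thus ?case by (simp only: trig_poly.monomial)
  next
    case (scale f c)
    thus ?case using trig_poly.scale[OF scale.IH, of c] by (simp add: mult_ac)
  next
    case (add f g)
    thus ?case using trig_poly.add[OF add.IH] by (simp add: algebra_simps)
  qed
next
  case (scale f c)
  thus ?case using trig_poly.scale[OF scale.IH, of c] by (simp add: mult_ac)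
next
  case (add f g)
  thus ?case using trig_poly.add[OF add.IH] by (simp add: algebra_simps)
qed

text \<open>On the unit circle \<open>Re z\<close> and \<open>Im z\<close> are combinations of
  \<open>z\<close> and its inverse, and these become the frequencies \<open>q\<close> and
  \<open>- q\<close>.\<close>

lemma trig_poly_polynomial:
  assumes "real_polynomial_function (h :: complex \<Rightarrow> real)"
  shows "trig_poly q (\<lambda>x. of_real (h (exponential q x)))"
  using assms
proof induction
  case (linear h)
  then interpret bounded_linear h .
  have h: "h z = Re z * h 1 + Im z * h \<i>" for z
  proof -
    have "h z = h (Re z *\<^sub>R 1 + Im z *\<^sub>R \<i>)" by (rule arg_cong[of _ _ h]) (simp add: complex_eq_iff)
    also have "\<dots> = Re z * h 1 + Im z * h \<i>" by (simp only: add scaleR real_scaleR_def)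
    finally show ?thesis .
  qed
  have "complex_of_real (h (exponential q x)) =
      (of_real (h 1) / 2 + of_real (h \<i>) / (2 * \<i>)) * exponential (q * of_int 1) x +
      (of_real (h 1) / 2 - of_real (h \<i>) / (2 * \<i>)) * exponential (q * of_int (-1)) x" for x
  proof -
    define u v where "u = h 1" and "v = h \<i>"
    have re: "complex_of_real (Re (exponential q x)) = (exponential q x + exponential (- q) x) / 2"
      and im: "complex_of_real (Im (exponential q x)) = (exponential q x - exponential (- q) x) /
          (2 * \<i>)"
      by (simp_all add: complex_eq_iff exponential_eq_cis Re_divide Im_divide)
    show ?thesis
      unfolding h[of "exponential q x"] u_def[symmetric] v_def[symmetric] of_real_add of_real_mult
          re im
      by (simp add: add_divide_distrib diff_divide_distrib algebra_simps)
  qed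
  hence "(\<lambda>x. complex_of_real (h (exponential q x))) =
    (\<lambda>x. (of_real (h 1) / 2 + of_real (h \<i>) / (2 * \<i>)) * exponential (q * of_int 1) x +
         (of_real (h 1) / 2 - of_real (h \<i>) / (2 * \<i>)) * exponential (q * of_int (-1)) x)"
    by (rule ext)
  thus ?case by (simp only: trig_poly.scale trig_poly.add trig_poly.monomial)
next
  case (const c)
  show ?case by (rule trig_poly_const)
next
  case (add f g)
  thus ?case using trig_poly.add by simp
next
  case (mult f g)
  thus ?case using trig_poly_mult by simp
qed

lemma trig_poly_bounded: "trig_poly q f \<Longrightarrow> \<exists>B. \<forall>x. cmod (f x) \<le> B"
proof (induction rule: trig_poly.induct)
  case (scale f c)
  then obtain B where "\<forall>x. cmod (f x) \<le> B" by blast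
  hence "\<forall>x. cmod (c * f x) \<le> cmod c * B" by (simp add: norm_mult mult_left_mono)
  thus ?case by blast
next
  case (add f g)
  then obtain B C where "\<forall>x. cmod (f x) \<le> B" "\<forall>x. cmod (g x) \<le> C" by blast
  hence "\<forall>x. cmod (f x + g x) \<le> B + C" by (metis add_mono norm_triangle_le)
  thus ?case by blast
qed auto

lemma trig_poly_measurable: "trig_poly q f \<Longrightarrow> f \<in> borel_measurable borel"
  by (induction rule: trig_poly.induct) auto

lemma integrable_mult_bounded:
  fixes f g :: "'a \<Rightarrow> complex"
  assumes "integrable M g" "f \<in> borel_measurable M" "\<And>x. cmod (f x) \<le> B"
  shows "integrable M (\<lambda>x. g x * f x)"
proof (rule Bochner_Integration.integrable_bound)
  show "integrable M (\<lambda>x. B * cmod (g x))" using assms by simp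
  have "0 \<le> B" using assms(3) norm_ge_zero order_trans by metis
  hence "cmod (g x * f x) \<le> norm (B * cmod (g x))" for x
    using mult_left_mono[OF assms(3)[of x] norm_ge_zero[of "g x"]]
    by (simp add: norm_mult abs_mult mult.commute)
  thus "AE x in M. cmod (g x * f x) \<le> norm (B * cmod (g x))" by simp
qed (use assms in measurable)

context
  fixes g :: "real \<Rightarrow> complex" and q :: real
  assumes g: "integrable lborel g"
    and coeff: "\<And>n :: int. (LINT x|lborel. g x * exponential (q * of_int n) x) = 0"
begin

lemma trig_poly_integral_zero:
  assumes "trig_poly q f"
  shows "integrable lborel (\<lambda>x. g x * f x) \<and> (LINT x|lborel. g x * f x) = 0"
proof
  have *: "integrable lborel (\<lambda>x. g x * f x)" if f: "trig_poly q f" for f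
  proof -
    from trig_poly_bounded[OF f] obtain B where "\<forall>x. cmod (f x) \<le> B" by blast
    thus ?thesis using trig_poly_measurable[OF f] g by (intro integrable_mult_bounded) auto
  qed
  show "integrable lborel (\<lambda>x. g x * f x)" using * assms .
  show "(LINT x|lborel. g x * f x) = 0" using assms
  proof induction
    case (scale f c)
    have "(LINT x|lborel. g x * (c * f x)) = (LINT x|lborel. c * (g x * f x))"
        by (simp add: mult_ac)
    thus ?case using scale by simp
  next
    case (add f f')
    thus ?case using *[of f] *[of f'] by (simp add: distrib_left)
  qed (use coeff in simp)
qed

text \<open>Stone-Weierstrass on the compact circle: a uniform approximation changes the integral by
  at most its error times the L1 norm of \<open>g\<close>.\<close>

lemma circle_integral_zero:
  assumes "continuous_on (sphere 0 1) (\<psi> :: complex \<Rightarrow> real)"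
  shows "integrable lborel (\<lambda>x. g x * of_real (\<psi> (exponential q x)))"
    and "(LINT x|lborel. g x * of_real (\<psi> (exponential q x))) = 0"
proof -
  let ?f = "\<lambda>x. complex_of_real (\<psi> (exponential q x))"
  have meas: "?f \<in> borel_measurable borel"
    by (intro borel_measurable_continuous_onI continuous_on_of_real
        continuous_on_compose2[OF assms continuous_on_exponential]) auto
  have "compact (\<psi> ` sphere 0 1)" using assms by (intro compact_continuous_image) auto
  from compact_imp_bounded[OF this] obtain B where "\<forall>y\<in>\<psi> ` sphere 0 1. norm y \<le> B"
    unfolding bounded_iff by blast
  hence "cmod (?f x) \<le> B" for x by simp
  thus int: "integrable lborel (\<lambda>x. g x * ?f x)" using g meas
      by (intro integrable_mult_bounded) auto
  have "cmod (LINT x|lborel. g x * ?f x) \<le> e" if "e > 0" for e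
  proof -
    \<comment> \<open>Adding 1 keeps the divisor positive even when \<open>g\<close> vanishes almost
      everywhere.\<close>
    define N where "N = (LINT x|lborel. cmod (g x)) + 1"
    have "N > 0" unfolding N_def by (simp add: add_nonneg_pos)
    obtain h where h: "real_polynomial_function h"
      and approx: "\<And>z. z \<in> sphere 0 1 \<Longrightarrow> \<bar>\<psi> z - h z\<bar> < e / N"
      using Stone_Weierstrass_real_polynomial_function[of "sphere 0 1 :: complex set" \<psi> "e / N"]
          assms \<open>N > 0\<close> \<open>e > 0\<close>
      by auto
    let ?h = "\<lambda>x. complex_of_real (h (exponential q x))"
    have th: "integrable lborel (\<lambda>x. g x * ?h x)" "(LINT x|lborel. g x * ?h x) = 0"
      using trig_poly_integral_zero[OF trig_poly_polynomial[OF h]] by auto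
    have "(LINT x|lborel. g x * ?f x) = (LINT x|lborel. g x * ?f x - g x * ?h x)"
      using int th by simp
    also have "cmod \<dots> \<le> (LINT x|lborel. cmod (g x * ?f x - g x * ?h x))"
        by (rule integral_norm_bound)
    also have "\<dots> \<le> (LINT x|lborel. e / N * cmod (g x))"
    proof (rule integral_mono)
      fix x
      have "cmod (g x * ?f x - g x * ?h x) = cmod (g x) * \<bar>\<psi> (exponential q x) - h (exponential q
          x)\<bar>"
        by (simp add: norm_mult flip: right_diff_distrib of_real_diff)
      also have "\<dots> \<le> cmod (g x) * (e / N)" using approx[of "exponential q x"]
          by (intro mult_left_mono) auto
      finally show "cmod (g x * ?f x - g x * ?h x) \<le> e / N * cmod (g x)" by (simp add: mult.commute)
    qed (use int th g in auto)
    also have "\<dots> = e / N * (N - 1)" by (simp add: N_def)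
    also have "\<dots> \<le> e" using \<open>N > 0\<close> \<open>e > 0\<close> by (simp add: field_simps)
    finally show ?thesis .
  qed
  hence "cmod (LINT x|lborel. g x * ?f x) \<le> 0" by (metis field_le_epsilon add_0)
  thus "(LINT x|lborel. g x * ?f x) = 0" by simp
qed

end

section \<open>From vanishing coefficients to vanishing almost everywhere\<close>

lemma subset_Pow_UNIV: "G \<subseteq> Pow UNIV"
  by simp

lemma greaterThan_Int_greaterThan: "{a<..} \<inter> {b<..} = {max a b<..}" for a b :: real
  by auto

text \<open>Dynkin's argument: open half-lines generate the Borel sets and are closed under
  intersection, and sets with integral zero pass to complements because the total integral is
  zero.\<close>

lemma AE_zero_if_greaterThan_integrals_zero:
  fixes g :: "real \<Rightarrow> complex"
  assumes g: "integrable lborel g"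
    and zero: "\<And>a. (LINT x|lborel. indicator {a<..} x *\<^sub>R g x) = 0"
    and total: "(LINT x|lborel. g x) = 0"
  shows "AE x in lborel. g x = 0"
proof (rule sigma_finite_measure.density_zero[OF sigma_finite_lborel g])
  have sets_iff: "A \<in> sigma_sets UNIV (range greaterThan) \<longleftrightarrow> A \<in> sets lborel" for A :: "real set"
    by (simp add: borel_Ioi sets_measure_of)
  have stable: "Int_stable (range (greaterThan :: real \<Rightarrow> _))"
    by (auto simp: Int_stable_def greaterThan_Int_greaterThan)
  fix A :: "real set" assume "A \<in> sets lborel"
  with sets_iff have "A \<in> sigma_sets UNIV (range greaterThan)" by blast
  with stable show "set_lebesgue_integral lborel A g = 0"
  proof (induction rule: sigma_sets_induct_disjoint[OF _ subset_Pow_UNIV, consumes 2, case_names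
      basic empty compl union])
    case (compl A)
    hence A: "A \<in> sets lborel" using sets_iff by blast
    have "set_integrable lborel A g" "set_integrable lborel (- A) g" unfolding set_integrable_def
      using A g by (auto intro!: integrable_mult_indicator)
    hence "set_lebesgue_integral lborel (A \<union> - A) g = set_lebesgue_integral lborel A g
        + set_lebesgue_integral lborel (- A) g"
      by (intro set_integral_Un) auto
    thus ?case using compl total by (simp add: set_lebesgue_integral_def Compl_eq_Diff_UNIV)
  next
    case (union A)
    hence A: "A i \<in> sets lborel" for i using sets_iff by blast
    have "set_lebesgue_integral lborel (\<Union>i. A i) g = (\<Sum>i. set_lebesgue_integral lborel (A i) g)"
    proof (rule lebesgue_integral_countable_add)
      show "set_integrable lborel (\<Union>i. A i) g" unfolding set_integrable_def
        using A g by (intro integrable_mult_indicator) auto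
    qed (use A union in \<open>auto simp: disjoint_family_on_def\<close>)
    thus ?case using union by simp
  qed (use zero in \<open>auto simp: set_lebesgue_integral_def\<close>)
qed

text \<open>Inside one period, the half-line beyond \<open>a\<close> is the preimage of the
  complement of a closed arc. The indicator of that complement is a bounded pointwise limit of
  continuous functions on the circle, so dominated convergence applies.\<close>

lemma AE_zero_if_Fourier_coefficients_zero:
  fixes g :: "real \<Rightarrow> complex" and q :: real
  assumes q: "q > 0" and g: "integrable lborel g"
    and supp: "\<And>x. x \<notin> {0..<1 / q} \<Longrightarrow> g x = 0"
    and coeff: "\<And>n :: int. (LINT x|lborel. g x * exponential (q * of_int n) x) = 0"
  shows "AE x in lborel. g x = 0"
proof (rule AE_zero_if_greaterThan_integrals_zero[OF g])
  show total: "(LINT x|lborel. g x) = 0" using coeff[of 0] by simp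
  fix a :: real
  consider "a < 0" | "a \<ge> 1 / q" | "0 \<le> a" "a < 1 / q" by linarith
  thus "(LINT x|lborel. indicator {a<..} x *\<^sub>R g x) = 0"
  proof cases
    case 1
    have "indicator {a<..} x *\<^sub>R g x = g x" for x using 1 supp[of x] by (auto simp: indicator_def)
    thus ?thesis using total by presburger
  next
    case 2
    show ?thesis by (rule integral_eq_zero_AE, rule AE_I2) (use 2 supp in \<open>auto simp:
        indicator_def\<close>)
  next
    case 3
    define K where "K = exponential q ` {0..a}"
    have "compact K" unfolding K_def by (intro compact_continuous_image continuous_on_exponential)
        auto
    moreover have "K \<noteq> {}" using 3 by (auto simp: K_def)
    ultimately have K: "infdist z K = 0 \<longleftrightarrow> z \<in> K" for z
      using in_closed_iff_infdist_zero compact_imp_closed by metis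
    have mem: "exponential q x \<in> K \<longleftrightarrow> x \<le> a" if x: "x \<in> {0..<1 / q}" for x
    proof
      assume "exponential q x \<in> K"
      then obtain y where y: "0 \<le> y" "y \<le> a" "exponential q x = exponential q y"
          by (auto simp: K_def)
      have "exponential q x = exponential q y * exponential q (x - y)"
          by (simp flip: exponential_add)
      hence "exponential q (x - y) = 1" using y by simp
      hence "q * (x - y) \<in> \<int>" by (simp add: exponential_eq_1_iff)
      \<comment> \<open>Both points lie in the same half-open period, so equal values on the circle
        force equal points.\<close>
      moreover have "\<bar>x - y\<bar> < 1 / q" using x y 3 by auto
      hence "q * \<bar>x - y\<bar> < 1" using q by (simp add: field_simps)
      hence "\<bar>q * (x - y)\<bar> < 1" using q by (simp only: abs_mult abs_of_pos)
      ultimately have "q * (x - y) = 0" by (rule Ints_nonzero_abs_less1)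
      thus "x \<le> a" using q y by simp
    qed (use x in \<open>auto simp: K_def\<close>)
    \<comment> \<open>Zero on the arc \<open>K\<close>, and equal to 1 at each point off
      \<open>K\<close> once \<open>m\<close> is large.\<close>
    define \<psi> where "\<psi> m z = min 1 (real m * infdist z K)" for m z
    have cont: "continuous_on (sphere 0 1) (\<psi> m)" for m
      unfolding \<psi>_def by (intro continuous_intros)
    have "(\<lambda>m. LINT x|lborel. g x * of_real (\<psi> m (exponential q x)))
      \<longlonglongrightarrow> (LINT x|lborel. indicator {a<..} x *\<^sub>R g x)"
    proof (rule integral_dominated_convergence[where w = "\<lambda>x. cmod (g x)"])
      show "(\<lambda>x. indicator {a<..} x *\<^sub>R g x) \<in> borel_measurable lborel" using g by measurable
      show "(\<lambda>x. g x * of_real (\<psi> m (exponential q x))) \<in> borel_measurable lborel" for m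
        using circle_integral_zero(1)[OF g coeff cont] by (rule borel_measurable_integrable)
      show "AE x in lborel. cmod (g x * of_real (\<psi> m (exponential q x))) \<le> cmod (g x)" for m
        by (auto simp: \<psi>_def norm_mult infdist_nonneg intro!: mult_left_le)
      show "AE x in lborel. (\<lambda>m. g x * of_real (\<psi> m (exponential q x)))
          \<longlonglongrightarrow> indicator {a<..} x *\<^sub>R g x"
      proof (rule AE_I2)
        fix x
        show "(\<lambda>m. g x * of_real (\<psi> m (exponential q x))) \<longlonglongrightarrow> indicator {a<..} x *\<^sub>R g x"
        proof (cases "x \<in> {0..<1 / q}")
          case x: True
          show ?thesis
          proof (cases "x \<le> a")
            case True
            hence "infdist (exponential q x) K = 0" using mem[OF x] K by blast
            thus ?thesis using True by (simp add: \<psi>_def)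
          next
            case False
            hence pos: "infdist (exponential q x) K > 0" using mem[OF x] K infdist_nonneg
                by (metis less_eq_real_def)
            have "\<forall>\<^sub>F m in sequentially. real m * infdist (exponential q x) K \<ge> 1"
              using eventually_ge_at_top[of "nat \<lceil>1 / infdist (exponential q x) K\<rceil>"]
            proof eventually_elim
              case (elim m)
              hence "1 / infdist (exponential q x) K \<le> real m" by linarith
              thus ?case using pos by (simp add: field_simps)
            qed
            hence "\<forall>\<^sub>F m in sequentially. g x * of_real (\<psi> m (exponential q x)) = g x"
              by eventually_elim (simp add: \<psi>_def)
            thus ?thesis using False by (simp add: tendsto_eventually)
          qed
        qed (simp add: supp)
      qed
    qed (use g in auto)
    moreover have "(LINT x|lborel. g x * of_real (\<psi> m (exponential q x))) = 0" for m
      by (rule circle_integral_zero(2)[OF g coeff cont])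
    ultimately show ?thesis by (simp add: LIMSEQ_const_iff)
  qed
qed

section \<open>Fibres\<close>

lemma integral_exponential_period:
  fixes q s :: real and n :: int
  assumes q: "q > 0" and n: "n \<noteq> 0"
  shows "(LINT x|lborel. indicator {s..<s + 1 / q} x *\<^sub>R exponential (q * of_int n) x) = 0"
proof -
  define a where "a = q * of_int n"
  have a: "a \<noteq> 0" using q n by (simp add: a_def)
  let ?c = "2 * of_real pi * \<i> * of_real a :: complex"
  have "?c \<noteq> 0" using a by simp
  have "((\<lambda>x. exponential a x / ?c) has_vector_derivative exponential a x) (at x within {s..s
      + 1 / q})" for x
  proof -
    have "((\<lambda>z. exp (?c * z) / ?c) has_field_derivative exp (?c * of_real x)) (at (of_real x))"
      using \<open>?c \<noteq> 0\<close> by (auto intro!: derivative_eq_intros)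
    hence "((\<lambda>x. exp (?c * of_real x) / ?c) has_vector_derivative exp (?c * of_real x)) (at x
        within {s..s + 1 / q})"
      by (intro has_vector_derivative_real_field)
    thus ?thesis by (simp add: exponential_def)
  qed
  hence "(LINT x|lborel. indicator {s..s + 1 / q} x *\<^sub>R exponential a x)
    = exponential a (s + 1 / q) / ?c - exponential a s / ?c"
    using q by (intro integral_FTC_Icc continuous_on_exponential) auto
  also have "exponential a (s + 1 / q) = exponential a s * exponential a (1 / q)"
    by (rule exponential_add)
  also have "exponential a (1 / q) = 1" using q by (simp add: exponential_eq_1_iff a_def)
  also have "(LINT x|lborel. indicator {s..s + 1 / q} x *\<^sub>R exponential a x)
    = (LINT x|lborel. indicator {s..<s + 1 / q} x *\<^sub>R exponential a x)"
  proof (rule integral_cong_AE)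
    have "AE x in lborel. x \<noteq> s + 1 / q" by (rule AE_lborel_singleton)
    thus "AE x in lborel. indicator {s..s + 1 / q} x *\<^sub>R exponential a x
      = indicator {s..<s + 1 / q} x *\<^sub>R exponential a x"
      by eventually_elim (auto simp: indicator_def)
  qed measurable
  finally show ?thesis by (simp add: a_def)
qed

lemma AE_lborel_shift:
  fixes t :: real
  assumes "AE x in lborel. Q x"
  shows "AE x in lborel. Q (t + x)"
proof (rule AE_distrD[where f = "(+) t" and P = Q and M' = borel])
  show "AE x in distr lborel borel ((+) t). Q x" unfolding lborel_distr_plus by (rule assms)
qed simp

lemma floor_translate_mem:
  fixes q y :: real
  assumes "q > 0"
  shows "y - of_int k / q \<in> {0..<1 / q} \<longleftrightarrow> k = \<lfloor>q * y\<rfloor>"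
proof -
  have "y - of_int k / q \<in> {0..<1 / q} \<longleftrightarrow> of_int k \<le> q * y \<and> q * y < of_int k + 1"
  proof -
    define u where "u = y - of_int k / q"
    have "q * y = q * u + of_int k" using assms by (simp add: u_def algebra_simps)
    moreover have "u < 1 / q \<longleftrightarrow> q * u < 1" using assms by (simp add: pos_less_divide_eq mult.commute)
    moreover have "0 \<le> u \<longleftrightarrow> 0 \<le> q * u" using assms by (simp add: zero_le_mult_iff)
    ultimately show ?thesis by (auto simp flip: u_def)
  qed
  also have "\<dots> \<longleftrightarrow> \<lfloor>q * y\<rfloor> = k" by (simp add: floor_eq_iff)
  finally show ?thesis by (simp only: eq_commute)
qed

text \<open>Unfolding: because \<open>exponential (q * n)\<close> has period 1/q, the coefficients
  of the periodization over one period are those of \<open>f\<close> over the line. The finite set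
  \<open>K\<close> keeps the periodization a finite sum.\<close>

lemma periodization_AE_zero:
  fixes f :: "real \<Rightarrow> complex" and q :: real
  assumes q: "q > 0" and f: "integrable lborel f" and K: "finite K"
    and supp: "\<And>x k. x \<in> {0..<1 / q} \<Longrightarrow> k \<notin> K \<Longrightarrow> f (x + of_int k / q) = 0"
    and coeff: "\<And>n :: int. (LINT x|lborel. f x * exponential (q * of_int n) x) = 0"
  shows "AE x in lborel. x \<in> {0..<1 / q} \<longrightarrow> (\<Sum>k\<in>K. f (x + of_int k / q)) = 0"
proof -
  define g where "g x = indicator {0..<1 / q} x *\<^sub>R (\<Sum>k\<in>K. f (x + of_int k / q))" for x
  have shift: "integrable lborel (\<lambda>x. f (x + t))" for t
    using lborel_integrable_real_affine[OF f, of 1 t] by (simp add: add.commute)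
  have g: "integrable lborel g" unfolding g_def
    by (intro integrable_mult_indicator Bochner_Integration.integrable_sum shift) simp
  have "AE x in lborel. g x = 0"
  proof (rule AE_zero_if_Fourier_coefficients_zero[OF q g])
    fix n :: int
    let ?e = "exponential (q * of_int n)"
    let ?J = "\<lambda>k :: int. {of_int k / q..<of_int k / q + 1 / q}"
    have int: "integrable lborel (\<lambda>y. indicator (?J k) y *\<^sub>R (f y * ?e y))" for k
      by (intro integrable_mult_indicator integrable_mult_bounded[where B = 1] f) auto
    have int': "integrable lborel (\<lambda>x. indicator {0..<1 / q} x *\<^sub>R (f (x + of_int k / q) * ?e x))"
        for k
      by (intro integrable_mult_indicator integrable_mult_bounded[where B = 1] shift) auto
    have "(LINT x|lborel. g x * ?e x)
      = (LINT x|lborel. (\<Sum>k\<in>K. indicator {0..<1 / q} x *\<^sub>R (f (x + of_int k / q) * ?e x)))"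
      by (simp add: g_def sum_distrib_right scaleR_sum_right)
    also have "\<dots> = (\<Sum>k\<in>K. (LINT x|lborel. indicator {0..<1 / q} x *\<^sub>R (f (x
        + of_int k / q) * ?e x)))"
      by (rule Bochner_Integration.integral_sum) (rule int')
    also have "\<dots> = (\<Sum>k\<in>K. (LINT y|lborel. indicator (?J k) y *\<^sub>R (f y * ?e y)))"
    proof (rule sum.cong[OF refl])
      fix k
      have "?e (of_int k / q + x) = ?e x" for x
      proof -
        have "?e (of_int k / q) = 1" using q by (simp add: exponential_eq_1_iff flip: of_int_mult)
        thus ?thesis by (simp add: exponential_add)
      qed
      moreover have "indicator (?J k) (of_int k / q + x) = (indicator {0..<1 / q} x :: real)" for x
        by (simp add: indicator_def)
      ultimately show "(LINT x|lborel. indicator {0..<1 / q} x *\<^sub>R (f (x + of_int k / q) * ?e x))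
        = (LINT y|lborel. indicator (?J k) y *\<^sub>R (f y * ?e y))"
        by (subst (2) lborel_integral_real_affine[where c = 1 and t
            = "of_int k / q"]) (simp_all add: add.commute)
    qed
    also have "\<dots> = (LINT y|lborel. (\<Sum>k\<in>K. indicator (?J k) y *\<^sub>R (f y * ?e y)))"
      by (rule Bochner_Integration.integral_sum[symmetric]) (rule int)
    also have "\<dots> = (LINT y|lborel. f y * ?e y)"
    proof (rule Bochner_Integration.integral_cong[OF refl])
      fix y
      have J: "y \<in> ?J k \<longleftrightarrow> k = \<lfloor>q * y\<rfloor>" for k
        using floor_translate_mem[OF q, of y k] by (auto simp: algebra_simps)
      have "f y = 0" if "\<lfloor>q * y\<rfloor> \<notin> K"
        using supp[of "y - of_int \<lfloor>q * y\<rfloor> / q", OF _ that] floor_translate_mem[OF q, of y] by simp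
      moreover have "(\<Sum>k\<in>K. indicator (?J k) y *\<^sub>R (f y * ?e y)) = (\<Sum>k\<in>K. if k
          = \<lfloor>q * y\<rfloor> then f y * ?e y else 0)"
        by (rule sum.cong) (use J in \<open>auto simp: indicator_def simp del: atLeastLessThan_iff\<close>)
      ultimately show "(\<Sum>k\<in>K. indicator (?J k) y *\<^sub>R (f y * ?e y)) = f y * ?e y"
        using K by (simp add: sum.delta)
    qed
    finally show "(LINT x|lborel. g x * ?e x) = 0" by (simp only: coeff)
  qed (simp add: g_def)
  thus ?thesis by eventually_elim (auto simp: g_def)
qed

definition fiber :: "real \<Rightarrow> real set \<Rightarrow> real \<Rightarrow> int set" where
  "fiber q \<Omega> x = {k. x + of_int k / q \<in> \<Omega>}"

lemma fiber_shift: "fiber q \<Omega> (x + of_int j / q) = (\<lambda>k. k - j) ` fiber q \<Omega> x"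
proof
  show "fiber q \<Omega> (x + of_int j / q) \<subseteq> (\<lambda>k. k - j) ` fiber q \<Omega> x"
  proof
    fix k assume "k \<in> fiber q \<Omega> (x + of_int j / q)"
    hence "k + j \<in> fiber q \<Omega> x" by (simp add: fiber_def add_divide_distrib add_ac)
    thus "k \<in> (\<lambda>k. k - j) ` fiber q \<Omega> x" by (intro image_eqI[of _ _ "k + j"]) simp_all
  qed
qed (auto simp: fiber_def diff_divide_distrib)

lemma fiber_bounded:
  assumes "bounded \<Omega>" "q > 0"
  shows "\<exists>K. finite K \<and> (\<forall>x\<in>{0..<1 / q}. fiber q \<Omega> x \<subseteq> K)"
proof -
  obtain B where B: "\<And>y. y \<in> \<Omega> \<Longrightarrow> \<bar>y\<bar> \<le> B" using assms(1) by (auto simp: bounded_iff)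
  have "fiber q \<Omega> x \<subseteq> {- \<lceil>q * B + 1\<rceil>..\<lceil>q * B + 1\<rceil>}" if x: "x \<in> {0..<1 / q}" for x
  proof
    fix k assume "k \<in> fiber q \<Omega> x"
    hence "\<bar>x + of_int k / q\<bar> \<le> B" using B by (simp add: fiber_def)
    hence "q * \<bar>x + of_int k / q\<bar> \<le> q * B" using assms by simp
    hence "\<bar>q * (x + of_int k / q)\<bar> \<le> q * B" using assms by (simp only: abs_mult abs_of_pos)
    hence "\<bar>q * x + of_int k\<bar> \<le> q * B" using assms by (simp add: distrib_left)
    moreover have "0 \<le> q * x" "q * x < 1" using x assms by (auto simp: field_simps)
    ultimately have "of_int k \<le> q * B + 1" "- of_int k \<le> q * B + 1" by linarith+
    thus "k \<in> {- \<lceil>q * B + 1\<rceil>..\<lceil>q * B + 1\<rceil>}" by (simp; linarith)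
  qed
  thus ?thesis by (intro exI[of _ "{- \<lceil>q * B + 1\<rceil>..\<lceil>q * B + 1\<rceil>}"]) simp
qed

text \<open>Countably many translates of one period cover the line, and countably many null sets may
  be discarded.\<close>

lemma AE_translation_invariant:
  fixes q :: real
  assumes q: "q > 0" and AE: "AE x in lborel. x \<in> {0..<1 / q} \<longrightarrow> P x"
    and inv: "\<And>x j. P x \<Longrightarrow> P (x + of_int j / q)"
  shows "AE x in lborel. P x"
proof -
  have "AE x in lborel. \<forall>j :: int. - of_int j / q + x \<in> {0..<1 / q} \<longrightarrow> P (- of_int j / q + x)"
    unfolding AE_all_countable using AE_lborel_shift[OF AE] by blast
  thus ?thesis
  proof eventually_elim
    case (elim x)
    have "x - of_int \<lfloor>q * x\<rfloor> / q \<in> {0..<1 / q}" using floor_translate_mem[OF q] by blast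
    hence "P (- of_int \<lfloor>q * x\<rfloor> / q + x)" using elim by (auto simp: algebra_simps)
    from inv[OF this, of "\<lfloor>q * x\<rfloor>"] show ?case by simp
  qed
qed

lemma integrable_indicator_exponential:
  assumes "bounded \<Omega>" "\<Omega> \<in> sets borel"
  shows "integrable lborel (\<lambda>x. indicator \<Omega> x *\<^sub>R exponential a x)"
proof -
  have "emeasure lborel \<Omega> < \<infinity>" using assms by (intro emeasure_bounded_finite)
  hence "integrable lborel (\<lambda>x. complex_of_real (indicator \<Omega> x))"
    using assms by (intro integrable_of_real integrable_real_indicator) auto
  from integrable_mult_bounded[OF this, of "exponential a" 1] show ?thesis
    by (simp add: scaleR_conv_of_real)
qed

text \<open>The indicator of \<open>\<Omega>\<close> times \<open>exponential \<theta>\<close> is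
  periodized; over each \<open>x\<close> the unit factor \<open>exponential \<theta> x\<close>
  splits off and leaves the sum over the fibre.\<close>

lemma fiber_sum_AE_zero:
  assumes q: "q > 0" and \<Omega>: "bounded \<Omega>" "\<Omega> \<in> sets borel"
    and coeff: "\<And>n :: int. (LINT x|lborel. indicator \<Omega> x *\<^sub>R exponential (\<theta> + q * of_int n) x) = 0"
  shows "AE x in lborel. (\<Sum>k\<in>fiber q \<Omega> x. exponential (\<theta> / q) (of_int k)) = 0"
proof (rule AE_translation_invariant[OF q])
  obtain K where K: "finite K" "\<And>x. x \<in> {0..<1 / q} \<Longrightarrow> fiber q \<Omega> x \<subseteq> K"
    using fiber_bounded[OF \<Omega>(1) q] by blast
  define f where "f x = indicator \<Omega> x *\<^sub>R exponential \<theta> x" for x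
  have "AE x in lborel. x \<in> {0..<1 / q} \<longrightarrow> (\<Sum>k\<in>K. f (x + of_int k / q)) = 0"
  proof (rule periodization_AE_zero[OF q _ K(1)])
    show "integrable lborel f" unfolding f_def by (rule integrable_indicator_exponential[OF \<Omega>])
    show "f (x + of_int k / q) = 0" if "x \<in> {0..<1 / q}" "k \<notin> K" for x k
      using K(2)[OF that(1)] that(2) by (auto simp: f_def fiber_def indicator_def)
    show "(LINT x|lborel. f x * exponential (q * of_int n) x) = 0" for n :: int
      using coeff[of n] by (simp add: f_def exponential_add_freq)
  qed
  thus "AE x in lborel. x \<in> {0..<1 / q} \<longrightarrow> (\<Sum>k\<in>fiber q \<Omega> x. exponential (\<theta> / q) (of_int k)) = 0"
  proof eventually_elim
    case (elim x)
    show ?case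
    proof
      assume x: "x \<in> {0..<1 / q}"
      have "(\<Sum>k\<in>K. f (x + of_int k / q)) = (\<Sum>k\<in>fiber q \<Omega> x. f (x + of_int k / q))"
        by (rule sum.mono_neutral_right) (use K x in \<open>auto simp: f_def fiber_def indicator_def\<close>)
      also have "\<dots> = (\<Sum>k\<in>fiber q \<Omega> x. exponential \<theta> x * exponential (\<theta> / q) (of_int k))"
        by (rule sum.cong) (auto simp: f_def fiber_def exponential_add, simp add:
            exponential_eq_cis)
      also have "\<dots> = exponential \<theta> x * (\<Sum>k\<in>fiber q \<Omega> x. exponential (\<theta> / q) (of_int k))"
        by (simp add: sum_distrib_left)
      finally show "(\<Sum>k\<in>fiber q \<Omega> x. exponential (\<theta> / q) (of_int k)) = 0" using elim x by simp
    qed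
  qed
  fix x j assume *: "(\<Sum>k\<in>fiber q \<Omega> x. exponential (\<theta> / q) (of_int k)) = 0"
  have "(\<Sum>k\<in>fiber q \<Omega> (x + of_int j / q). exponential (\<theta> / q) (of_int k))
    = (\<Sum>k\<in>fiber q \<Omega> x. exponential (\<theta> / q) (of_int (k - j)))"
    unfolding fiber_shift by (subst sum.reindex) (auto simp: inj_on_def)
  also have "\<dots> = exponential (\<theta> / q) (- of_int j) * (\<Sum>k\<in>fiber q \<Omega> x. exponential (\<theta> / q) (of_int
      k))"
    by (simp add: sum_distrib_left flip: exponential_add)
  finally show "(\<Sum>k\<in>fiber q \<Omega> (x + of_int j / q). exponential (\<theta> / q) (of_int k)) = 0"
      by (simp add: *)
qed

text \<open>Subtracting \<open>p\<close> times the indicator of one period also removes the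
  coefficient at 0, since \<open>\<Omega>\<close> has measure 1 and the period 1/p. The
  periodization of the difference is the fibre cardinality minus \<open>p\<close>.\<close>

lemma fiber_card_AE:
  fixes p :: nat
  assumes p: "p > 0" and \<Omega>: "bounded \<Omega>" "\<Omega> \<in> sets borel" and one: "emeasure lborel \<Omega> = 1"
    and coeff: "\<And>n :: int. n \<noteq> 0 \<Longrightarrow> (LINT x|lborel. indicator \<Omega> x *\<^sub>R exponential (real p * of_int
        n) x) = 0"
  shows "AE x in lborel. card (fiber (real p) \<Omega> x) = p"
proof (rule AE_translation_invariant[of "real p"])
  show q: "real p > 0" using p by simp
  obtain K0 where K0: "finite K0" "\<And>x. x \<in> {0..<1 / real p} \<Longrightarrow> fiber (real p) \<Omega> x \<subseteq> K0"
    using fiber_bounded[OF \<Omega>(1) q] by blast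
  \<comment> \<open>The index 0 is added because the subtracted indicator lives on the period
    itself.\<close>
  define K where "K = insert 0 K0"
  let ?J = "{0..<1 / real p}"
  define f :: "real \<Rightarrow> complex" where
    "f x = indicator \<Omega> x *\<^sub>R 1 - of_nat p * (indicator ?J x *\<^sub>R 1)" for x
  have intO: "integrable lborel (\<lambda>x. indicator \<Omega> x *\<^sub>R exponential a x)" for a
    by (rule integrable_indicator_exponential[OF \<Omega>])
  have intJ: "integrable lborel (\<lambda>x. indicator ?J x *\<^sub>R exponential a x)" for a
    by (intro integrable_indicator_exponential bounded_Ico) simp
  have J: "x + of_int k / real p \<in> ?J \<longleftrightarrow> k = 0" if "x \<in> ?J" for x k
  proof -
    have "\<lfloor>real p * x\<rfloor> = 0" using that p by (auto simp: floor_eq_iff field_simps)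
    thus ?thesis using floor_translate_mem[OF q, of x "- k"] by auto
  qed
  have "AE x in lborel. x \<in> ?J \<longrightarrow> (\<Sum>k\<in>K. f (x + of_int k / real p)) = 0"
  proof (rule periodization_AE_zero[OF q])
    show "integrable lborel f" unfolding f_def using intO[of 0] intJ[of 0] by simp
    show "finite K" using K0 by (simp add: K_def)
    show "f (x + of_int k / real p) = 0" if "x \<in> ?J" "k \<notin> K" for x k
    proof -
      have "x + of_int k / real p \<notin> \<Omega>" using K0(2)[OF that(1)] that(2)
          by (auto simp: K_def fiber_def)
      moreover have "x + of_int k / real p \<notin> ?J" using J[OF that(1), of k] that(2)
          by (auto simp: K_def)
      ultimately show ?thesis by (simp add: f_def indicator_def del: atLeastLessThan_iff)
    qed
    show "(LINT x|lborel. f x * exponential (real p * of_int n) x) = 0" for n :: int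
    proof -
      have "(LINT x|lborel. f x * exponential (real p * of_int n) x)
        = (LINT x|lborel. indicator \<Omega> x *\<^sub>R exponential (real p * of_int n) x
            - of_nat p * (indicator ?J x *\<^sub>R exponential (real p * of_int n) x))"
        by (rule Bochner_Integration.integral_cong) (auto simp: f_def algebra_simps)
      also have "\<dots> = (LINT x|lborel. indicator \<Omega> x *\<^sub>R exponential (real p * of_int n) x)
        - of_nat p * (LINT x|lborel. indicator ?J x *\<^sub>R exponential (real p * of_int n) x)"
        by (simp only: Bochner_Integration.integral_diff[OF intO integrable_mult_right[OF intJ]]
            integral_mult_right_zero)
      also have "\<dots> = 0"
      proof (cases "n = 0")
        case True
        have "(LINT x|lborel. indicator \<Omega> x *\<^sub>R (1 :: complex)) = 1"
          using one \<Omega> by (subst Bochner_Integration.integral_scaleR_left) (auto simp: measure_def)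
        moreover have "(LINT x|lborel. indicator ?J x *\<^sub>R (1 :: complex)) = 1 / of_nat p"
          by (subst Bochner_Integration.integral_scaleR_left) (auto simp: scaleR_conv_of_real)
        ultimately show ?thesis using True p by simp
      next
        case False
        thus ?thesis using coeff integral_exponential_period[OF q, of n 0] by simp
      qed
      finally show ?thesis .
    qed
  qed
  thus "AE x in lborel. x \<in> ?J \<longrightarrow> card (fiber (real p) \<Omega> x) = p"
  proof eventually_elim
    case (elim x)
    show ?case
    proof
      assume x: "x \<in> ?J"
      have fin: "finite K" using K0 by (simp add: K_def)
      have sub: "fiber (real p) \<Omega> x \<subseteq> K" using K0(2)[OF x] by (auto simp: K_def)
      have "(\<Sum>k\<in>K. f (x + of_int k / real p))
        = (\<Sum>k\<in>K. if k \<in> fiber (real p) \<Omega> x then 1 else 0) - (\<Sum>k\<in>K. if k = 0 then of_nat p else 0)"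
        unfolding sum_subtractf[symmetric]
        by (rule sum.cong) (use J[OF x] in \<open>auto simp: f_def fiber_def indicator_def simp del:
            atLeastLessThan_iff\<close>)
      also have "\<dots> = of_nat (card (fiber (real p) \<Omega> x)) - of_nat p"
        using fin sub by (simp add: K_def[symmetric] sum.If_cases Int_absorb1 Int_absorb2) (simp
            add: K_def)
      finally show "card (fiber (real p) \<Omega> x) = p" using elim x by (simp flip: of_nat_diff)
    qed
  qed
  fix x j assume "card (fiber (real p) \<Omega> x) = p"
  thus "card (fiber (real p) \<Omega> (x + of_int j / real p)) = p"
    unfolding fiber_shift by (subst card_image) (auto simp: inj_on_def)
qed

section \<open>Completeness of the spectrum\<close>

lemma integral_lebesgue_on_borel:
  fixes f :: "real \<Rightarrow> 'b::{banach, second_countable_topology}"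
  assumes [measurable]: "\<Omega> \<in> sets borel" "f \<in> borel_measurable borel"
  shows "(LINT x|lebesgue_on \<Omega>. f x) = (LINT x|lborel. indicator \<Omega> x *\<^sub>R f x)"
proof -
  have "(LINT x|lebesgue_on \<Omega>. f x) = (LINT x|lebesgue. indicator \<Omega> x *\<^sub>R f x)"
    by (rule integral_restrict_space) simp
  also have "\<dots> = (LINT x|lborel. indicator \<Omega> x *\<^sub>R f x)" by (rule integral_completion) measurable
  finally show ?thesis .
qed

lemma inj_exponential: "inj exponential"
proof
  fix a b assume "exponential a = exponential b"
  hence one: "exponential (a - b) x = 1" for x
    using exponential_add_freq[of "a - b" b x] by simp
  show "a = b"
  proof (rule ccontr)
    assume "a \<noteq> b"
    hence "exponential (a - b) (1 / (2 * (a - b))) = -1"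
      by (intro exponential_eq_neg_1_iff[THEN iffD2] exI[of _ 0]) simp
    thus False using one by simp
  qed
qed

lemma spectrum_orthogonal:
  assumes "has_spectrum \<Omega> \<Lambda>" and \<Omega>: "\<Omega> \<in> sets borel" and \<xi>: "\<xi> \<in> \<Lambda>" "\<mu> \<in> \<Lambda>" "\<xi> \<noteq> \<mu>"
  shows "(LINT x|lborel. indicator \<Omega> x *\<^sub>R exponential (\<xi> - \<mu>) x) = 0"
proof -
  have "exponential \<xi> \<noteq> exponential \<mu>" using inj_exponential \<xi>(3) by (meson injD)
  hence "0 = L2_inner (lebesgue_on \<Omega>) (exponential \<xi>) (exponential \<mu>)"
    using assms by (auto simp: has_spectrum_def orthogonal_basis_L2_def)
  also have "\<dots> = (LINT x|lebesgue_on \<Omega>. exponential (\<xi> - \<mu>) x)"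
    by (simp add: L2_inner_def cnj_exponential flip: exponential_add_freq)
  also have "\<dots> = (LINT x|lborel. indicator \<Omega> x *\<^sub>R exponential (\<xi> - \<mu>) x)"
    using \<Omega> by (intro integral_lebesgue_on_borel) auto
  finally show ?thesis by simp
qed

text \<open>The squared norm is multiplied out, and orthogonality on \<open>S\<close> kills the
  mixed terms. Since \<open>\<beta>\<close> integrates the exponential without conjugation, it is
  the conjugate of the usual coefficient. The identity serves twice: on an interval for Bessel's
  inequality, and on \<open>\<Omega>\<close> for completeness.\<close>

lemma indicator_approximation_error:
  fixes c :: "real \<Rightarrow> complex"
  assumes S: "bounded S" "S \<in> sets borel" and B: "B \<in> sets borel" "B \<subseteq> S" and F: "finite F"
    and orth: "\<And>\<xi> \<mu>. \<xi> \<in> F \<Longrightarrow> \<mu> \<in> F \<Longrightarrow> \<xi> \<noteq> \<mu> \<Longrightarrow>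
      (LINT x|lborel. indicator S x *\<^sub>R exponential (\<xi> - \<mu>) x) = 0"
  defines "\<beta> \<equiv> \<lambda>a. (LINT x|lborel. indicator B x *\<^sub>R exponential a x)"
  shows "(LINT x|lborel. indicator S x * (cmod (indicator B x - (\<Sum>\<xi>\<in>F. c \<xi> * exponential \<xi> x)))\<^sup>2)
    = measure lborel B - (\<Sum>\<xi>\<in>F. 2 * Re (c \<xi> * \<beta> \<xi>)) + measure lborel S * (\<Sum>\<xi>\<in>F. (cmod (c \<xi>))\<^sup>2)"
proof -
  have Bb: "bounded B" using S B bounded_subset by blast
  have intS: "integrable lborel (\<lambda>x. indicator S x *\<^sub>R exponential a x)" for a
    by (rule integrable_indicator_exponential[OF S])
  have intB: "integrable lborel (\<lambda>x. indicator B x *\<^sub>R exponential a x)" for a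
    by (rule integrable_indicator_exponential[OF Bb B(1)])
  have total: "(LINT x|lborel. indicator A x *\<^sub>R exponential 0 x) = of_real (measure lborel A)"
    if "bounded A" "A \<in> sets borel" for A
  proof -
    have "emeasure lborel A < \<infinity>" using that by (intro emeasure_bounded_finite)
    hence "integrable lborel (indicator A :: real \<Rightarrow> real)" using that
        by (intro integrable_real_indicator) auto
    hence "(LINT x|lborel. indicator A x *\<^sub>R (1::complex)) = (LINT x|lborel. indicator A x) *\<^sub>R 1"
      by (intro Bochner_Integration.integral_scaleR_left) auto
    thus ?thesis using that by (simp add: scaleR_conv_of_real)
  qed
  let ?G = "\<lambda>x. \<Sum>\<xi>\<in>F. c \<xi> * exponential \<xi> x"
  let ?h = "\<lambda>x. indicator B x *\<^sub>R exponential 0 x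
      - (\<Sum>\<xi>\<in>F. cnj (c \<xi>) * (indicator B x *\<^sub>R exponential (- \<xi>) x)
          + c \<xi> * (indicator B x *\<^sub>R exponential \<xi> x))
      + (\<Sum>\<xi>\<in>F. \<Sum>\<mu>\<in>F. c \<xi> * cnj (c \<mu>) * (indicator S x *\<^sub>R exponential (\<xi> - \<mu>) x))"
  have expand: "complex_of_real (indicator S x * (cmod (indicator B x - ?G x))\<^sup>2) = ?h x" for x
  proof -
    let ?b = "indicator B x :: complex" and ?s = "indicator S x :: complex"
    have bs: "?s * ?b = ?b" "?b * ?b = ?b" using B by (auto simp: indicator_def)
    have cb: "cnj ?b = ?b" by (simp add: indicator_def)
    have "complex_of_real (indicator S x * (cmod (indicator B x - ?G x))\<^sup>2)
      = ?s * ((?b - ?G x) * cnj (?b - ?G x))"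
      by (simp add: complex_norm_square[symmetric] of_real_indicator del: complex_cnj_diff)
    also have "\<dots> = ?s * ?b * ?b - (?s * ?b) * cnj (?G x) - (?s * ?b) * ?G x
        + ?s * (?G x * cnj (?G x))"
      by (simp only: complex_cnj_diff cb) (simp add: algebra_simps)
    also have "\<dots> = ?b - (?b * cnj (?G x) + ?b * ?G x) + ?s * (?G x * cnj (?G x))"
      by (simp only: bs) simp
    also have "?G x * cnj (?G x) = (\<Sum>\<xi>\<in>F. \<Sum>\<mu>\<in>F. c \<xi> * cnj (c \<mu>) * exponential (\<xi> - \<mu>) x)"
      unfolding cnj_sum sum_product
      by (intro sum.cong refl) (simp add: cnj_exponential exponential_add_freq[of _ "- _",
          simplified])
    also have "?b * cnj (?G x) + ?b * ?G x =
      (\<Sum>\<xi>\<in>F. cnj (c \<xi>) * (?b * exponential (- \<xi>) x) + c \<xi> * (?b * exponential \<xi> x))"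
      by (simp add: cnj_exponential sum_distrib_left sum.distrib mult_ac)
    finally show ?thesis
      by (simp add: scaleR_conv_of_real of_real_indicator sum_distrib_left mult_ac)
  qed
  have beta_neg: "\<beta> (- a) = cnj (\<beta> a)" for a
    unfolding \<beta>_def by (subst Bochner_Integration.integral_cnj[symmetric]) (simp add:
        cnj_exponential)
  have i1: "integrable lborel (\<lambda>x. \<Sum>\<xi>\<in>F. cnj (c \<xi>) * (indicator B x *\<^sub>R exponential (- \<xi>) x)
      + c \<xi> * (indicator B x *\<^sub>R exponential \<xi> x))"
    by (intro Bochner_Integration.integrable_sum Bochner_Integration.integrable_add
        integrable_mult_right intB)
  have i2: "integrable lborel (\<lambda>x. \<Sum>\<xi>\<in>F. \<Sum>\<mu>\<in>F. c \<xi> * cnj (c \<mu>) * (indicator S x *\<^sub>R exponential (\<xi>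
      - \<mu>) x))"
    by (intro Bochner_Integration.integrable_sum integrable_mult_right intS)
  have s1: "(LINT x|lborel. (\<Sum>\<xi>\<in>F. cnj (c \<xi>) * (indicator B x *\<^sub>R exponential (- \<xi>) x)
      + c \<xi> * (indicator B x *\<^sub>R exponential \<xi> x))) = (\<Sum>\<xi>\<in>F. of_real (2 * Re (c \<xi> * \<beta> \<xi>)))"
  proof -
    have "(LINT x|lborel. (\<Sum>\<xi>\<in>F. cnj (c \<xi>) * (indicator B x *\<^sub>R exponential (- \<xi>) x)
      + c \<xi> * (indicator B x *\<^sub>R exponential \<xi> x))) = (\<Sum>\<xi>\<in>F. cnj (c \<xi>) * \<beta> (- \<xi>) + c \<xi> * \<beta> \<xi>)"
      unfolding \<beta>_def
      by (subst Bochner_Integration.integral_sum, intro Bochner_Integration.integrable_add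
          integrable_mult_right intB)
         (simp only: Bochner_Integration.integral_add[OF integrable_mult_right[OF intB]
             integrable_mult_right[OF intB]]
            integral_mult_right_zero)
    also have "\<dots> = (\<Sum>\<xi>\<in>F. of_real (2 * Re (c \<xi> * \<beta> \<xi>)))"
    proof (rule sum.cong[OF refl])
      fix \<xi>
      have "cnj (c \<xi>) * \<beta> (- \<xi>) + c \<xi> * \<beta> \<xi> = c \<xi> * \<beta> \<xi> + cnj (c \<xi> * \<beta> \<xi>)" by (simp add: beta_neg)
      thus "cnj (c \<xi>) * \<beta> (- \<xi>) + c \<xi> * \<beta> \<xi> = of_real (2 * Re (c \<xi> * \<beta> \<xi>))"
        by (simp only: complex_add_cnj)
    qed
    finally show ?thesis .
  qed
  have s2: "(LINT x|lborel. (\<Sum>\<xi>\<in>F. \<Sum>\<mu>\<in>F. c \<xi> * cnj (c \<mu>) * (indicator S x *\<^sub>R exponential (\<xi> - \<mu>)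
      x)))
      = of_real (measure lborel S * (\<Sum>\<xi>\<in>F. (cmod (c \<xi>))\<^sup>2))"
  proof -
    have "(LINT x|lborel. (\<Sum>\<xi>\<in>F. \<Sum>\<mu>\<in>F. c \<xi> * cnj (c \<mu>) * (indicator S x *\<^sub>R exponential (\<xi> - \<mu>) x)))
      = (\<Sum>\<xi>\<in>F. \<Sum>\<mu>\<in>F. c \<xi> * cnj (c \<mu>) * (LINT x|lborel. indicator S x *\<^sub>R exponential (\<xi> - \<mu>) x))"
      by (subst Bochner_Integration.integral_sum, intro Bochner_Integration.integrable_sum
          integrable_mult_right intS,
          intro sum.cong refl,
          subst Bochner_Integration.integral_sum, intro integrable_mult_right intS)
         (simp only: integral_mult_right_zero)
    also have "\<dots> = (\<Sum>\<xi>\<in>F. \<Sum>\<mu>\<in>F. if \<mu> = \<xi> then of_real (measure lborel S * (cmod (c \<xi>))\<^sup>2) else 0)"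
    proof (intro sum.cong refl)
      fix \<xi> \<mu> assume "\<xi> \<in> F" "\<mu> \<in> F"
      moreover have "c \<xi> * cnj (c \<xi>) * of_real (measure lborel S)
          = of_real (measure lborel S * (cmod (c \<xi>))\<^sup>2)"
        by (simp flip: complex_norm_square)
      ultimately show "c \<xi> * cnj (c \<mu>) * (LINT x|lborel. indicator S x *\<^sub>R exponential (\<xi> - \<mu>) x)
        = (if \<mu> = \<xi> then of_real (measure lborel S * (cmod (c \<xi>))\<^sup>2) else 0)"
        using orth[of \<xi> \<mu>] total[OF S] by (cases "\<mu> = \<xi>") auto
    qed
    also have "\<dots> = of_real (measure lborel S * (\<Sum>\<xi>\<in>F. (cmod (c \<xi>))\<^sup>2))"
      using F by (simp add: sum_distrib_left)
    finally show ?thesis .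
  qed
  have "complex_of_real (LINT x|lborel. indicator S x * (cmod (indicator B x - ?G x))\<^sup>2)
      = (LINT x|lborel. ?h x)"
    unfolding expand[symmetric] by (rule integral_complex_of_real[symmetric])
  also have "\<dots> = of_real (measure lborel B) - (\<Sum>\<xi>\<in>F. of_real (2 * Re (c \<xi> * \<beta> \<xi>)))
      + of_real (measure lborel S * (\<Sum>\<xi>\<in>F. (cmod (c \<xi>))\<^sup>2))"
    by (simp only: Bochner_Integration.integral_add[OF Bochner_Integration.integrable_diff[OF intB
        i1] i2]
        Bochner_Integration.integral_diff[OF intB i1] s1 s2 total[OF Bb B(1)])
  also have "\<dots> = of_real (measure lborel B - (\<Sum>\<xi>\<in>F. 2 * Re (c \<xi> * \<beta> \<xi>))
      + measure lborel S * (\<Sum>\<xi>\<in>F. (cmod (c \<xi>))\<^sup>2))" by simp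
  finally show ?thesis by (simp only: of_real_eq_iff)
qed

lemma bessel_indicator:
  assumes S: "bounded S" "S \<in> sets borel" "measure lborel S > 0"
    and B: "B \<in> sets borel" "B \<subseteq> S" and F: "finite F"
    and orth: "\<And>\<xi> \<mu>. \<xi> \<in> F \<Longrightarrow> \<mu> \<in> F \<Longrightarrow> \<xi> \<noteq> \<mu> \<Longrightarrow>
      (LINT x|lborel. indicator S x *\<^sub>R exponential (\<xi> - \<mu>) x) = 0"
  shows "(\<Sum>\<xi>\<in>F. (cmod (LINT x|lborel. indicator B x *\<^sub>R exponential \<xi> x))\<^sup>2)
      \<le> measure lborel S * measure lborel B"
proof -
  define \<beta> where "\<beta> a = (LINT x|lborel. indicator B x *\<^sub>R exponential a x)" for a
  define s where "s = measure lborel S"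
  have s: "s > 0" using S by (simp add: s_def)
  \<comment> \<open>The coefficients of the orthogonal projection, which minimise the error.\<close>
  define c where "c \<xi> = cnj (\<beta> \<xi>) / of_real s" for \<xi>
  have "0 \<le> (LINT x|lborel. indicator S x * (cmod (indicator B x - (\<Sum>\<xi>\<in>F. c \<xi> * exponential \<xi>
      x)))\<^sup>2)"
    by (intro Bochner_Integration.integral_nonneg) simp
  also have "\<dots> = measure lborel B - (\<Sum>\<xi>\<in>F. 2 * Re (c \<xi> * \<beta> \<xi>)) + s * (\<Sum>\<xi>\<in>F. (cmod (c \<xi>))\<^sup>2)"
    unfolding \<beta>_def s_def by (rule indicator_approximation_error[OF S(1,2) B F orth])
  also have "(\<Sum>\<xi>\<in>F. 2 * Re (c \<xi> * \<beta> \<xi>)) = (\<Sum>\<xi>\<in>F. 2 * ((cmod (\<beta> \<xi>))\<^sup>2 / s))"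
  proof (rule sum.cong[OF refl])
    fix \<xi>
    have "c \<xi> * \<beta> \<xi> = of_real ((cmod (\<beta> \<xi>))\<^sup>2 / s)"
      by (simp add: c_def complex_norm_square mult.commute del: of_real_power)
    thus "2 * Re (c \<xi> * \<beta> \<xi>) = 2 * ((cmod (\<beta> \<xi>))\<^sup>2 / s)"
        by (simp only: complex_of_real_def complex.sel)
  qed
  also have "s * (\<Sum>\<xi>\<in>F. (cmod (c \<xi>))\<^sup>2) = (\<Sum>\<xi>\<in>F. (cmod (\<beta> \<xi>))\<^sup>2 / s)"
    using s by (simp add: sum_distrib_left c_def norm_divide power_divide power2_eq_square)
  also have "(\<Sum>\<xi>\<in>F. 2 * ((cmod (\<beta> \<xi>))\<^sup>2 / s)) = 2 * (\<Sum>\<xi>\<in>F. (cmod (\<beta> \<xi>))\<^sup>2 / s)"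
    by (simp only: sum_distrib_left)
  finally have "(\<Sum>\<xi>\<in>F. (cmod (\<beta> \<xi>))\<^sup>2) / s \<le> measure lborel B"
    by (simp add: sum_divide_distrib)
  thus ?thesis using s by (simp add: \<beta>_def s_def field_simps)
qed

text \<open>Let \<open>B\<close> be a piece of \<open>\<Omega>\<close> of measure
  \<open>m > 0\<close> in an interval of length 1/p. Each class modulo \<open>p\<close> is
  orthogonal on that interval and so contributes at most \<open>m / p\<close> to the sum of squared
  coefficients. Fewer than \<open>p\<close> classes stay below \<open>m\<close> by a fixed amount,
  but approximating the indicator of \<open>B\<close> on \<open>\<Omega>\<close> arbitrarily well
  requires coming arbitrarily close to \<open>m\<close>.\<close>

lemma spectrum_not_covered:
  fixes p :: nat
  assumes p: "p > 0" and \<Omega>: "bounded \<Omega>" "\<Omega> \<in> sets borel" "emeasure lborel \<Omega> = 1"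
    and spec: "has_spectrum \<Omega> \<Lambda>" and \<Gamma>: "finite \<Gamma>" "card \<Gamma> < p"
  shows "\<exists>\<xi>\<in>\<Lambda>. \<forall>\<gamma>\<in>\<Gamma>. \<forall>n :: int. \<xi> \<noteq> \<gamma> + real p * of_int n"
proof (rule ccontr)
  assume "\<not> ?thesis"
  hence "\<forall>\<xi>\<in>\<Lambda>. \<exists>\<gamma>. \<gamma> \<in> \<Gamma> \<and> (\<exists>n :: int. \<xi> = \<gamma> + real p * of_int n)" by blast
  from bchoice[OF this] obtain h where
    h: "\<And>\<xi>. \<xi> \<in> \<Lambda> \<Longrightarrow> h \<xi> \<in> \<Gamma> \<and> (\<exists>n :: int. \<xi> = h \<xi> + real p * of_int n)" by blast
  have q: "real p > 0" using p by simp
  let ?J = "\<lambda>k :: int. {of_int k / real p..<of_int k / real p + 1 / real p}"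
  have one: "measure lborel \<Omega> = 1" using \<Omega>(3) by (simp add: measure_def)
  have "\<exists>k. emeasure lborel (\<Omega> \<inter> ?J k) \<noteq> 0"
  proof (rule ccontr)
    assume "\<not> ?thesis"
    hence "\<Omega> \<inter> ?J k \<in> null_sets lborel" for k using \<Omega>(2) by (auto simp: null_sets_def)
    hence "(\<Union>k :: int. \<Omega> \<inter> ?J k) \<in> null_sets lborel" by (intro null_sets_UN) simp
    moreover have "(\<Union>k. \<Omega> \<inter> ?J k) = \<Omega>"
    proof -
      have "x \<in> ?J \<lfloor>real p * x\<rfloor>" for x
        using floor_translate_mem[OF q, of x "\<lfloor>real p * x\<rfloor>"] by (auto simp: algebra_simps)
      thus ?thesis by blast
    qed
    ultimately show False using \<Omega>(3) by (simp add: null_sets_def)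
  qed
  then obtain k0 where k0: "emeasure lborel (\<Omega> \<inter> ?J k0) \<noteq> 0" by blast
  define J where "J = ?J k0"
  define B where "B = \<Omega> \<inter> J"
  define m where "m = measure lborel B"
  have B: "B \<in> sets borel" "B \<subseteq> \<Omega>" "B \<subseteq> J" using \<Omega>(2) by (auto simp: B_def J_def)
  have J: "bounded J" "J \<in> sets borel" "measure lborel J = 1 / real p" by (auto simp: J_def)
  have "emeasure lborel B < \<infinity>" by (rule emeasure_bounded_finite[OF bounded_subset[OF \<Omega>(1) B(2)]])
  hence "m > 0" using k0 unfolding m_def B_def[symmetric] J_def[symmetric]
    by (simp add: measure_def enn2real_positive_iff zero_less_iff_neq_zero top.not_eq_extremum)
  define \<beta> where "\<beta> a = (LINT x|lborel. indicator B x *\<^sub>R exponential a x)" for a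
  define f :: "real \<Rightarrow> complex" where "f = indicator B"
  \<comment> \<open>Its square is the part of \<open>m\<close> that \<open>card \<Gamma>\<close>
    classes cannot account for.\<close>
  define \<epsilon> where "\<epsilon> = sqrt (m * (1 - real (card \<Gamma>) / real p))"
  have "m * (1 - real (card \<Gamma>) / real p) > 0" using \<open>m > 0\<close> \<Gamma>(2) by (simp add: field_simps)
  hence \<epsilon>: "\<epsilon> > 0" "\<epsilon>\<^sup>2 = m * (1 - real (card \<Gamma>) / real p)" by (simp_all add: \<epsilon>_def)
  have f_meas: "f \<in> borel_measurable borel" unfolding f_def using B by measurable
  have "square_integrable (lebesgue_on \<Omega>) f"
    unfolding square_integrable_def
  proof
    have "f \<in> borel_measurable lebesgue" using f_meas by (intro measurable_completion) simp
    thus "f \<in> borel_measurable (lebesgue_on \<Omega>)" by (rule measurable_restrict_space1)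
    have "integrable lborel (indicator B :: real \<Rightarrow> real)"
      using B \<open>emeasure lborel B < \<infinity>\<close> by (intro integrable_real_indicator) auto
    moreover have "indicator B = (\<lambda>x. indicator \<Omega> x *\<^sub>R (cmod (f x))\<^sup>2)"
      using B by (auto simp: f_def indicator_def fun_eq_iff)
    ultimately have "integrable lborel (\<lambda>x. indicator \<Omega> x *\<^sub>R (cmod (f x))\<^sup>2)" by simp
    hence "integrable lebesgue (\<lambda>x. indicator \<Omega> x *\<^sub>R (cmod (f x))\<^sup>2)"
      by (subst integrable_completion) auto
    thus "integrable (lebesgue_on \<Omega>) (\<lambda>x. (cmod (f x))\<^sup>2)"
      using \<Omega>(2) by (subst integrable_restrict_space) auto
  qed
  moreover have "\<forall>f. square_integrable (lebesgue_on \<Omega>) f \<longrightarrow> (\<forall>\<epsilon>>0. \<exists>F c. finite F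
      \<and> F \<subseteq> exponential ` \<Lambda> \<and>
      L2_norm (lebesgue_on \<Omega>) (\<lambda>x. f x - (\<Sum>g\<in>F. c g * g x)) < \<epsilon>)"
    using spec unfolding has_spectrum_def orthogonal_basis_L2_def by (elim conjE)
  ultimately have "\<exists>F c. finite F \<and> F \<subseteq> exponential ` \<Lambda> \<and>
      L2_norm (lebesgue_on \<Omega>) (\<lambda>x. f x - (\<Sum>g\<in>F. c g * g x)) < \<epsilon>" using \<epsilon>(1) by presburger
  then obtain G c where G: "finite G" "G \<subseteq> exponential ` \<Lambda>"
    "L2_norm (lebesgue_on \<Omega>) (\<lambda>x. f x - (\<Sum>g\<in>G. c g * g x)) < \<epsilon>"
    by (elim exE conjE)
  obtain F where F: "F \<subseteq> \<Lambda>" "finite F" "G = exponential ` F"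
    using finite_subset_image[OF G(1,2)] by blast
  define d where "d \<xi> = c (exponential \<xi>)" for \<xi>
  have sum_G: "(\<Sum>g\<in>G. c g * g x) = (\<Sum>\<xi>\<in>F. d \<xi> * exponential \<xi> x)" for x
    unfolding F(3) d_def by (subst sum.reindex) (auto intro: inj_on_subset[OF inj_exponential])
  let ?X = "LINT x|lborel. indicator \<Omega> x * (cmod (indicator B x - (\<Sum>\<xi>\<in>F. d \<xi> * exponential \<xi> x)))\<^sup>2"
  have "L2_norm (lebesgue_on \<Omega>) (\<lambda>x. f x - (\<Sum>g\<in>G. c g * g x)) = sqrt ?X"
    unfolding L2_norm_def sum_G
  proof (subst integral_lebesgue_on_borel[OF \<Omega>(2)])
    show "(\<lambda>x. (cmod (f x - (\<Sum>\<xi>\<in>F. d \<xi> * exponential \<xi> x)))\<^sup>2) \<in> borel_measurable borel"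
      using f_meas by measurable
  qed (simp add: f_def)
  hence "sqrt ?X < \<epsilon>" using G(3) by simp
  hence "?X < \<epsilon>\<^sup>2" using real_le_rsqrt not_less by blast
  \<comment> \<open>Applied on \<open>J\<close> rather than \<open>\<Omega>\<close>: the smaller
    measure is the source of the factor 1/p.\<close>
  have bessel: "(\<Sum>\<xi>\<in>{\<xi> \<in> F. h \<xi> = \<gamma>}. (cmod (\<beta> \<xi>))\<^sup>2) \<le> 1 / real p * m" for \<gamma>
    unfolding \<beta>_def m_def J(3)[symmetric]
  proof (rule bessel_indicator[OF J(1,2) _ B(1,3)])
    show "0 < measure lborel J" using J p by simp
    show "finite {\<xi> \<in> F. h \<xi> = \<gamma>}" using F by simp
    fix \<xi> \<mu> assume *: "\<xi> \<in> {\<xi> \<in> F. h \<xi> = \<gamma>}" "\<mu> \<in> {\<xi> \<in> F. h \<xi> = \<gamma>}" "\<xi> \<noteq> \<mu>"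
    hence "\<xi> \<in> \<Lambda>" "h \<xi> = \<gamma>" "\<mu> \<in> \<Lambda>" "h \<mu> = \<gamma>" using F(1) by auto
    then obtain n n' :: int where "\<xi> = \<gamma> + real p * of_int n" "\<mu> = \<gamma> + real p * of_int n'"
      using h[of \<xi>] h[of \<mu>] by auto
    hence "\<xi> - \<mu> = real p * of_int (n - n')" "n - n' \<noteq> 0" using *(3) by (auto simp: algebra_simps)
    thus "(LINT x|lborel. indicator J x *\<^sub>R exponential (\<xi> - \<mu>) x) = 0"
      unfolding J_def using integral_exponential_period[OF q] by presburger
  qed
  have "(\<Sum>\<xi>\<in>F. (cmod (\<beta> \<xi>))\<^sup>2) = (\<Sum>\<gamma>\<in>\<Gamma>. \<Sum>\<xi>\<in>{\<xi> \<in> F. h \<xi> = \<gamma>}. (cmod (\<beta> \<xi>))\<^sup>2)"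
    by (rule sum.group[symmetric]) (use F \<Gamma> h in auto)
  also have "\<dots> \<le> (\<Sum>\<gamma>\<in>\<Gamma>. 1 / real p * m)" by (rule sum_mono) (rule bessel)
  also have "\<dots> = real (card \<Gamma>) / real p * m" by simp
  finally have upper: "(\<Sum>\<xi>\<in>F. (cmod (\<beta> \<xi>))\<^sup>2) \<le> real (card \<Gamma>) / real p * m" .
  have "?X = m - (\<Sum>\<xi>\<in>F. 2 * Re (d \<xi> * \<beta> \<xi>)) + 1 * (\<Sum>\<xi>\<in>F. (cmod (d \<xi>))\<^sup>2)"
    unfolding one[symmetric] m_def \<beta>_def
    by (rule indicator_approximation_error[OF \<Omega>(1,2) B(1,2) F(2)])
       (use spectrum_orthogonal[OF spec \<Omega>(2)] F in auto)
  \<comment> \<open>Completing the square: the chosen coefficients enter only through a nonnegative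
    term.\<close>
  also have "\<dots> = m - (\<Sum>\<xi>\<in>F. (cmod (\<beta> \<xi>))\<^sup>2) + (\<Sum>\<xi>\<in>F. (cmod (cnj (d \<xi>) - \<beta> \<xi>))\<^sup>2)"
  proof -
    have "(cmod (cnj z - w))\<^sup>2 = (cmod w)\<^sup>2 - 2 * Re (z * w) + (cmod z)\<^sup>2" for z w
      unfolding cmod_power2 by (simp add: power2_eq_square algebra_simps)
    thus ?thesis by (simp add: sum.distrib sum_subtractf)
  qed
  also have "\<dots> \<ge> m - (\<Sum>\<xi>\<in>F. (cmod (\<beta> \<xi>))\<^sup>2)" by (simp add: sum_nonneg)
  finally have "?X \<ge> m - real (card \<Gamma>) / real p * m" using upper by linarith
  also have "m - real (card \<Gamma>) / real p * m = \<epsilon>\<^sup>2" by (simp add: \<epsilon>(2) algebra_simps)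
  finally show False using \<open>?X < \<epsilon>\<^sup>2\<close> by simp
qed

text \<open>Greedy choice: as long as fewer than \<open>p\<close> elements are chosen, their classes
  do not cover the spectrum.\<close>

lemma spectrum_incongruent_elements:
  fixes p :: nat
  assumes p: "p > 0" and \<Omega>: "bounded \<Omega>" "\<Omega> \<in> sets borel" "emeasure lborel \<Omega> = 1"
    and spec: "has_spectrum \<Omega> \<Lambda>" and "q \<le> p"
  shows "\<exists>\<Gamma>. finite \<Gamma> \<and> \<Gamma> \<subseteq> \<Lambda> \<and> card \<Gamma> = q \<and>
    (\<forall>\<gamma>\<in>\<Gamma>. \<forall>\<gamma>'\<in>\<Gamma>. \<gamma> \<noteq> \<gamma>' \<longrightarrow> (\<forall>n :: int. \<gamma> \<noteq> \<gamma>' + real p * of_int n))"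
  using \<open>q \<le> p\<close>
proof (induction q)
  case 0
  show ?case by (intro exI[of _ "{}"]) simp
next
  case (Suc q)
  then obtain \<Gamma> where \<Gamma>: "finite \<Gamma>" "\<Gamma> \<subseteq> \<Lambda>" "card \<Gamma> = q"
    "\<And>\<gamma> \<gamma>' n. \<gamma> \<in> \<Gamma> \<Longrightarrow> \<gamma>' \<in> \<Gamma> \<Longrightarrow> \<gamma> \<noteq> \<gamma>' \<Longrightarrow> \<gamma> \<noteq> \<gamma>' + real p * of_int (n :: int)" by auto
  obtain \<xi> where \<xi>: "\<xi> \<in> \<Lambda>" "\<And>\<gamma> n. \<gamma> \<in> \<Gamma> \<Longrightarrow> \<xi> \<noteq> \<gamma> + real p * of_int (n :: int)"
    using spectrum_not_covered[OF p \<Omega> spec \<Gamma>(1)] \<Gamma>(3) Suc.prems by auto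
  have "\<xi> \<notin> \<Gamma>" using \<xi>(2)[of \<xi> 0] by auto
  have \<xi>': "\<gamma> \<noteq> \<xi> + real p * of_int n" if "\<gamma> \<in> \<Gamma>" for \<gamma> and n :: int
    using \<xi>(2)[OF that, of "- n"] by auto
  show ?case
  proof (intro exI[of _ "insert \<xi> \<Gamma>"] conjI ballI impI allI)
    show "card (insert \<xi> \<Gamma>) = Suc q" using \<Gamma> \<open>\<xi> \<notin> \<Gamma>\<close> by simp
    fix \<gamma> \<gamma>' and n :: int assume "\<gamma> \<in> insert \<xi> \<Gamma>" "\<gamma>' \<in> insert \<xi> \<Gamma>" "\<gamma> \<noteq> \<gamma>'"
    thus "\<gamma> \<noteq> \<gamma>' + real p * of_int n" using \<Gamma>(4) \<xi>(2) \<xi>' by (elim insertE) simp_all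
  qed (use \<Gamma> \<xi> in auto)
qed

section \<open>From tilings by fibres to a tiling of the line\<close>

lemma negligible_if_AE_lborel:
  assumes "AE x in lborel. P x"
  shows "negligible {x :: real. \<not> P x}"
proof -
  obtain N where "{x. \<not> P x} \<subseteq> N" "N \<in> null_sets lborel"
    using assms by (auto elim: AE_E2 simp: eventually_ae_filter)
  thus ?thesis
    using negligible_iff_null_sets negligible_subset null_sets_completionI by metis
qed

text \<open>A point \<open>x\<close> lies in the translate by \<open>t / q\<close> exactly when
  \<open>- t\<close> is in its fibre. So representing 0 uniquely as a fibre element plus an element
  of \<open>T\<close> means that exactly one translate covers \<open>x\<close>.\<close>

lemma tiles_if_fibers_tile:
  assumes q: "q > 0" and AE: "AE x in lborel. int_tiles T (fiber q \<Omega> x)"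
  shows "tiles_by_translations \<Omega>"
proof -
  define N where "N = {x. \<not> int_tiles T (fiber q \<Omega> x)}"
  have N: "negligible N" unfolding N_def by (rule negligible_if_AE_lborel[OF AE])
  let ?s = "\<lambda>t :: int. of_int t / q"
  have mem: "x \<in> (\<lambda>x. x + ?s t) ` \<Omega> \<longleftrightarrow> - t \<in> fiber q \<Omega> x" for x t
  proof
    assume "- t \<in> fiber q \<Omega> x"
    thus "x \<in> (\<lambda>x. x + ?s t) ` \<Omega>"
      by (intro image_eqI[of _ _ "x + of_int (- t) / q"]) (simp_all add: fiber_def)
  qed (auto simp: fiber_def)
  have ex1: "\<exists>!a. a \<in> fiber q \<Omega> x \<and> - a \<in> T" if "x \<notin> N" for x
    using that unfolding N_def int_tiles_def mem_Collect_eq not_not by (drule_tac x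
        = 0 in spec) simp
  show ?thesis unfolding tiles_by_translations_def
  proof (intro exI[of _ "?s ` T"] conjI ballI impI)
    fix s t assume "s \<in> ?s ` T" "t \<in> ?s ` T" "s \<noteq> t"
    then obtain s' t' where st: "s' \<in> T" "t' \<in> T" "s = ?s s'" "t = ?s t'" "s' \<noteq> t'" by auto
    have "(\<lambda>x. x + s) ` \<Omega> \<inter> (\<lambda>x. x + t) ` \<Omega> \<subseteq> N"
    proof
      fix x assume "x \<in> (\<lambda>x. x + s) ` \<Omega> \<inter> (\<lambda>x. x + t) ` \<Omega>"
      hence "- s' \<in> fiber q \<Omega> x" "- t' \<in> fiber q \<Omega> x" unfolding st mem[symmetric] by simp_all
      thus "x \<in> N" using ex1[of x] st by (metis minus_minus)
    qed
    thus "negligible ((\<lambda>x. x + s) ` \<Omega> \<inter> (\<lambda>x. x + t) ` \<Omega>)" by (rule negligible_subset[OF N])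
  next
    have "UNIV - (\<Union>t\<in>?s ` T. (\<lambda>x. x + t) ` \<Omega>) \<subseteq> N"
    proof
      fix x assume x: "x \<in> UNIV - (\<Union>t\<in>?s ` T. (\<lambda>x. x + t) ` \<Omega>)"
      show "x \<in> N"
      proof (rule ccontr)
        assume "x \<notin> N"
        then obtain a where "a \<in> fiber q \<Omega> x" "- a \<in> T" using ex1 by blast
        hence "x \<in> (\<lambda>x. x + ?s (- a)) ` \<Omega>" unfolding mem by simp
        thus False using x \<open>- a \<in> T\<close> by blast
      qed
    qed
    thus "negligible (UNIV - (\<Union>t\<in>?s ` T. (\<lambda>x. x + t) ` \<Omega>))" by (rule negligible_subset[OF N])
  qed
qed

lemma periodic_set_add_multiple:
  fixes p :: real
  assumes per: "(\<lambda>x. x + p) ` \<Lambda> = \<Lambda>" and "x \<in> \<Lambda>"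
  shows "x + p * of_int n \<in> \<Lambda>"
proof (induction n rule: int_induct[of _ 0])
  case base
  show ?case using assms by simp
next
  case (step1 i)
  have "x + p * of_int (i + 1) = (x + p * of_int i) + p" by (simp add: algebra_simps)
  thus ?case using step1 per by (metis image_eqI)
next
  case (step2 i)
  then obtain y where "y \<in> \<Lambda>" "x + p * of_int i = y + p" using per
      by (metis (mono_tags, lifting) imageE)
  moreover from this have "x + p * of_int (i - 1) = y" by (simp add: algebra_simps)
  ultimately show ?case by simp
qed

theorem theorem1p26:
  fixes p :: nat and \<Omega> \<Lambda> :: "real set"
  assumes "p \<in> {2, 3, 4, 5}"
    and "bounded \<Omega>" and "\<Omega> \<in> sets borel" and "emeasure lebesgue \<Omega> = 1"
    and "has_spectrum \<Omega> \<Lambda>"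
    and "(\<lambda>x. x + real p) ` \<Lambda> = \<Lambda>"
  shows "tiles_by_translations \<Omega>"
proof -
  have p: "p > 0" using assms(1) by auto
  have one: "emeasure lborel \<Omega> = 1" using assms(3,4) by simp
  obtain \<Gamma> where \<Gamma>: "finite \<Gamma>" "\<Gamma> \<subseteq> \<Lambda>" "card \<Gamma> = p"
    and incong: "\<And>\<gamma> \<gamma>' n. \<gamma> \<in> \<Gamma> \<Longrightarrow> \<gamma>' \<in> \<Gamma> \<Longrightarrow> \<gamma> \<noteq> \<gamma>' \<Longrightarrow> \<gamma> \<noteq> \<gamma>' + real p * of_int (n :: int)"
    using spectrum_incongruent_elements[OF p assms(2,3) one assms(5) order_refl] by blast
  have period: "\<gamma> + real p * of_int n \<in> \<Lambda>" if "\<gamma> \<in> \<Gamma>" for \<gamma> n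
    using periodic_set_add_multiple[OF assms(6)] that \<Gamma>(2) by blast
  \<comment> \<open>Fibre points are spaced by 1/p, so a frequency \<open>\<gamma>\<close> acts on
    the integer \<open>k\<close> as \<open>\<gamma> / p\<close>.\<close>
  define L where "L = (\<lambda>\<gamma>. \<gamma> / real p) ` \<Gamma>"
  have card_L: "card L = p" unfolding L_def using \<Gamma>(3) p
      by (subst card_image) (auto simp: inj_on_def)
  have "AE x in lborel. card (fiber (real p) \<Omega> x) = p"
  proof (rule fiber_card_AE[OF p assms(2,3) one])
    fix n :: int assume "n \<noteq> 0"
    \<comment> \<open>By periodicity \<open>\<gamma>\<close> and \<open>\<gamma> + p * n\<close> are
      two distinct members of the spectrum, so orthogonality covers the frequency
      \<open>p * n\<close>.\<close>
    obtain \<gamma> where \<gamma>: "\<gamma> \<in> \<Gamma>" using \<Gamma>(3) p by fastforce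
    show "(LINT x|lborel. indicator \<Omega> x *\<^sub>R exponential (real p * of_int n) x) = 0"
      using spectrum_orthogonal[OF assms(5,3) period[OF \<gamma>, of n], of \<gamma>] \<gamma> \<Gamma>(2) \<open>n \<noteq> 0\<close> p by auto
  qed
  moreover have "AE x in lborel. \<forall>\<gamma>\<in>\<Gamma>. \<forall>\<gamma>'\<in>\<Gamma>. \<gamma> \<noteq> \<gamma>' \<longrightarrow>
    (\<Sum>k\<in>fiber (real p) \<Omega> x. exponential ((\<gamma>' - \<gamma>) / real p) (of_int k)) = 0"
  proof (intro AE_finite_allI \<Gamma>(1) AE_impI)
    fix \<gamma> \<gamma>' assume g: "\<gamma> \<in> \<Gamma>" "\<gamma>' \<in> \<Gamma>" "\<gamma> \<noteq> \<gamma>'"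
    show "AE x in lborel. (\<Sum>k\<in>fiber (real p) \<Omega> x. exponential ((\<gamma>' - \<gamma>) / real p) (of_int k)) = 0"
    proof (rule fiber_sum_AE_zero[OF _ assms(2,3)])
      show "(LINT x|lborel. indicator \<Omega> x *\<^sub>R exponential (\<gamma>' - \<gamma> + real p * of_int n) x) = 0" for n
      proof -
        \<comment> \<open>Incongruence keeps the two frequencies distinct for every
          \<open>n\<close>, so all coefficients vanish, the one at \<open>n = 0\<close>
          included.\<close>
        have "\<gamma>' + real p * of_int n \<noteq> \<gamma>" using incong[of \<gamma> \<gamma>' n] g by auto
        thus ?thesis
          using spectrum_orthogonal[OF assms(5,3) period[OF g(2), of n], of \<gamma>] g \<Gamma>(2)
          by (auto simp: algebra_simps)
      qed
    qed (use p in simp)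
  qed
  ultimately have "AE x in lborel. spectral_pair p L (fiber (real p) \<Omega> x)"
  proof eventually_elim
    case (elim x)
    thus ?case unfolding spectral_pair_def using card_L by (auto simp: L_def diff_divide_distrib)
  qed
  \<comment> \<open>\<open>T\<close> depends on \<open>L\<close> alone, so the same set serves
    almost every \<open>x\<close>.\<close>
  moreover obtain T where "\<And>A. spectral_pair p L A \<Longrightarrow> int_tiles T A"
    using common_tiling[OF assms(1)] by blast
  ultimately have "AE x in lborel. int_tiles T (fiber (real p) \<Omega> x)" by (auto elim: eventually_mono)
  thus ?thesis using p by (intro tiles_if_fibers_tile[of "real p"]) auto
qed

end
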